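(* There is a fixed first-order sentence $\Phi$ such that a given binary relation $R\subseteq S\times S$ is a bisimulation on a weighted transition system $\mathfrak{S}=\langle S,P,A,\delta,+\rangle$ if and only if $\mathfrak{S}_R\models\Phi$, where $\mathfrak{S}_R$ denotes the structure obtained by extending $\mathfrak{S}$ with the relation $R$. Furthermore, checking $\mathfrak{S}_R\models\Phi$ is decidable when both $\mathfrak{S}$ and $R$ are regular.
   Context: A weighted transition system (WTS) is a three-sorted structure $\mathfrak{S}=\langle S,P,A,\delta,+\rangle$, where $S$ is a countable set of configurations, $P$ is a countable set of nonnegative numbers, $A$ is a countable set of actions, $+:P\times P\to P$ is the addition operation over $P$, and $\delta:S\times A\times S\to P$ is the weighted transition function. Write $s\to_a t$ if $\delta(s,a,t)\neq 0$. Standing assumption: the WTSs considered have natural-number weights and are bounded branching, i.e. there exists a bound $b<\infty$ such that $|\{t\in S: s\to_a t\}|\le b$ for all $s\in S$ and $a\in A$. A bisimulation over $\mathfrak{S}$ is an equivalence relation $R\subseteq S\times S$ such that $(s,s')\in R$ implies $\sum_{t\in E}\delta(s,a,t)=\sum_{t'\in E}\delta(s',a,t')$ for all $a\in A$ and all $E\in S/R$, where $S/R$ is the set of equivalence classes of $R$. Regularity. Let $\Sigma$ be a finite alphabet, $\#\notin\Sigma$ a blank symbol, and $\Sigma_\#=\Sigma\cup\{\#\}$. The convolution $w_1\otimes\cdots\otimes w_k\in(\Sigma_\#^k)^*$ of words $w_1,\dots,w_k\in\Sigma^*$ is the word of length $\max_i|w_i|$ whose $j$-th letter is the tuple of the $j$-th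 letters of the $w_i$, with $\#$ in place of missing letters. A relation $R\subseteq(\Sigma^* )^k$ is regular if $\{w_1\otimes\cdots\otimes w_k:(w_1,\dots,w_k)\in R\}$ is a regular language. A structure is regular if its relational variant (functions replaced by their graphs) is isomorphic to a relational structure whose universes are regular languages over a finite alphabet and all of whose relations are regular; the latter is called a regular presentation of the structure. That both $\mathfrak{S}$ and $R$ are regular means that $\mathfrak{S}$ is given by a regular presentation in which $R$ is also a regular relation.
   Formalization: The sentence Φ and the decision procedure are fixed for each branching bound b (no Φ serves all b: first-order logic cannot compare unboundedly many successors); they are also stated per carrier of S and A, which loses nothing since every countable system is isomorphic to one over the naturals. *)

theory Defs
  imports "HOL-Analysis.Infinite_Sum" "HOL-Library.Nat_Bijection" "HOL-Library.Countable_Set"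
begin

section \<open>Weighted transition systems and bisimulations\<close>

text \<open>The addition of a system is the addition of natural numbers restricted to \<open>weights\<close>.\<close>

record ('s, 'a) wts =
  confs :: "'s set"
  weights :: "nat set"
  acts :: "'a set"
  wt :: "'s \<Rightarrow> 'a \<Rightarrow> 's \<Rightarrow> nat"

definition is_wts :: "('s, 'a) wts \<Rightarrow> bool" where
  "is_wts W \<longleftrightarrow>
     countable (confs W) \<and> countable (acts W) \<and>
     (\<forall>x\<in>weights W. \<forall>y\<in>weights W. x + y \<in> weights W) \<and>
     (\<forall>s\<in>confs W. \<forall>a\<in>acts W. \<forall>t\<in>confs W. wt W s a t \<in> weights W)"

definition bounded_branching :: "nat \<Rightarrow> ('s, 'a) wts \<Rightarrow> bool" where
  "bounded_branching b W \<longleftrightarrow>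
     (\<forall>s\<in>confs W. \<forall>a\<in>acts W.
        finite {t \<in> confs W. wt W s a t \<noteq> 0} \<and> card {t \<in> confs W. wt W s a t \<noteq> 0} \<le> b)"

definition bisimulation :: "('s, 'a) wts \<Rightarrow> ('s \<times> 's) set \<Rightarrow> bool" where
  "bisimulation W R \<longleftrightarrow>
     equiv (confs W) R \<and>
     (\<forall>(s, s')\<in>R. \<forall>a\<in>acts W. \<forall>E\<in>confs W // R.
        (\<Sum>\<^sub>\<infinity>t\<in>E. wt W s a t) = (\<Sum>\<^sub>\<infinity>t'\<in>E. wt W s' a t'))"


section \<open>First-order logic over the three-sorted signature\<close>

text \<open>
  The signature consists of the function symbols for \<open>\<delta>\<close> and \<open>+\<close>, a binary relation symbol on
  configurations, and equality on each sort. Each sort has its own variables, indexed by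
  natural numbers. No function symbol has values in configurations or actions, so the only
  terms of these two sorts are variables.
\<close>

datatype wterm =
    WVar nat
  | Delta nat nat nat
  | Plus wterm wterm

datatype fm =
    EqS nat nat
  | EqA nat nat
  | EqP wterm wterm
  | Rel nat nat
  | Neg fm
  | Conj fm fm
  | ExS nat fm
  | ExP nat fm
  | ExA nat fm

datatype var = SV nat | PV nat | AV nat

primrec wvars :: "wterm \<Rightarrow> var set" where
  "wvars (WVar x) = {PV x}"
| "wvars (Delta s a t) = {SV s, AV a, SV t}"
| "wvars (Plus u v) = wvars u \<union> wvars v"

primrec fv :: "fm \<Rightarrow> var set" where
  "fv (EqS s t) = {SV s, SV t}"
| "fv (EqA a c) = {AV a, AV c}"
| "fv (EqP u v) = wvars u \<union> wvars v"
| "fv (Rel s t) = {SV s, SV t}"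
| "fv (Neg \<phi>) = fv \<phi>"
| "fv (Conj \<phi> \<psi>) = fv \<phi> \<union> fv \<psi>"
| "fv (ExS x \<phi>) = fv \<phi> - {SV x}"
| "fv (ExP x \<phi>) = fv \<phi> - {PV x}"
| "fv (ExA x \<phi>) = fv \<phi> - {AV x}"

definition sentence :: "fm \<Rightarrow> bool" where
  "sentence \<phi> \<longleftrightarrow> fv \<phi> = {}"

primrec wval :: "('s, 'a) wts \<Rightarrow> (nat \<Rightarrow> 's) \<Rightarrow> (nat \<Rightarrow> nat) \<Rightarrow> (nat \<Rightarrow> 'a) \<Rightarrow> wterm \<Rightarrow> nat" where
  "wval W es ep ea (WVar x) = ep x"
| "wval W es ep ea (Delta s a t) = wt W (es s) (ea a) (es t)"
| "wval W es ep ea (Plus u v) = wval W es ep ea u + wval W es ep ea v"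

primrec sat :: "('s, 'a) wts \<Rightarrow> ('s \<times> 's) set \<Rightarrow> (nat \<Rightarrow> 's) \<Rightarrow> (nat \<Rightarrow> nat) \<Rightarrow> (nat \<Rightarrow> 'a) \<Rightarrow> fm \<Rightarrow> bool"
where
  "sat W R es ep ea (EqS s t) \<longleftrightarrow> es s = es t"
| "sat W R es ep ea (EqA a c) \<longleftrightarrow> ea a = ea c"
| "sat W R es ep ea (EqP u v) \<longleftrightarrow> wval W es ep ea u = wval W es ep ea v"
| "sat W R es ep ea (Rel s t) \<longleftrightarrow> (es s, es t) \<in> R"
| "sat W R es ep ea (Neg \<phi>) \<longleftrightarrow> \<not> sat W R es ep ea \<phi>"
| "sat W R es ep ea (Conj \<phi> \<psi>) \<longleftrightarrow> sat W R es ep ea \<phi> \<and> sat W R es ep ea \<psi>"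
| "sat W R es ep ea (ExS x \<phi>) \<longleftrightarrow> (\<exists>s\<in>confs W. sat W R (es(x := s)) ep ea \<phi>)"
| "sat W R es ep ea (ExP x \<phi>) \<longleftrightarrow> (\<exists>n\<in>weights W. sat W R es (ep(x := n)) ea \<phi>)"
| "sat W R es ep ea (ExA x \<phi>) \<longleftrightarrow> (\<exists>a\<in>acts W. sat W R es ep (ea(x := a)) \<phi>)"

text \<open>
  The value of a sentence does not depend on the assignment. The quantification is not relative
  to the universes, so that it is never vacuous, not even if a universe is empty.
\<close>

definition models :: "('s, 'a) wts \<Rightarrow> ('s \<times> 's) set \<Rightarrow> fm \<Rightarrow> bool" where
  "models W R \<phi> \<longleftrightarrow> (\<forall>es ep ea. sat W R es ep ea \<phi>)"


section \<open>Relational structures\<close>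

record ('s, 'p, 'a) rel_struct =
  US :: "'s set"
  UP :: "'p set"
  UA :: "'a set"
  DeltaR :: "('s \<times> 'a \<times> 's \<times> 'p) set"
  PlusR :: "('p \<times> 'p \<times> 'p) set"
  BinR :: "('s \<times> 's) set"

definition is_rel_struct :: "('s, 'p, 'a) rel_struct \<Rightarrow> bool" where
  "is_rel_struct T \<longleftrightarrow>
     DeltaR T \<subseteq> US T \<times> UA T \<times> US T \<times> UP T \<and>
     PlusR T \<subseteq> UP T \<times> UP T \<times> UP T \<and>
     BinR T \<subseteq> US T \<times> US T"

definition relational_variant ::
  "('s, 'a) wts \<Rightarrow> ('s \<times> 's) set \<Rightarrow> ('s, nat, 'a) rel_struct" where
  "relational_variant W R =
     \<lparr> US = confs W, UP = weights W, UA = acts W,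
       DeltaR = {(s, a, t, wt W s a t) | s a t. s \<in> confs W \<and> a \<in> acts W \<and> t \<in> confs W},
       PlusR = {(x, y, x + y) | x y. x \<in> weights W \<and> y \<in> weights W},
       BinR = R \<rparr>"

definition isomorphic ::
  "('s, 'p, 'a) rel_struct \<Rightarrow> ('t, 'q, 'c) rel_struct \<Rightarrow> bool" where
  "isomorphic T U \<longleftrightarrow>
     (\<exists>f g h.
        bij_betw f (US T) (US U) \<and> bij_betw g (UP T) (UP U) \<and> bij_betw h (UA T) (UA U) \<and>
        (\<forall>s\<in>US T. \<forall>a\<in>UA T. \<forall>t\<in>US T. \<forall>p\<in>UP T.
           (s, a, t, p) \<in> DeltaR T \<longleftrightarrow> (f s, h a, f t, g p) \<in> DeltaR U) \<and>
        (\<forall>x\<in>UP T. \<forall>y\<in>UP T. \<forall>z\<in>UP T.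
           (x, y, z) \<in> PlusR T \<longleftrightarrow> (g x, g y, g z) \<in> PlusR U) \<and>
        (\<forall>s\<in>US T. \<forall>t\<in>US T. (s, t) \<in> BinR T \<longleftrightarrow> (f s, f t) \<in> BinR U))"


section \<open>Finite automata and regular presentations\<close>

text \<open>Nondeterministic finite automata; the states are those that occur in the lists.\<close>

record 'l nfa =
  start :: "nat list"
  steps :: "(nat \<times> 'l \<times> nat) list"
  final :: "nat list"

primrec run :: "'l nfa \<Rightarrow> nat \<Rightarrow> 'l list \<Rightarrow> nat \<Rightarrow> bool" where
  "run M q [] q' \<longleftrightarrow> q = q'"
| "run M q (x # w) q' \<longleftrightarrow> (\<exists>r. (q, x, r) \<in> set (steps M) \<and> run M r w q')"

definition lang :: "'l nfa \<Rightarrow> 'l list set" where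
  "lang M = {w. \<exists>q\<in>set (start M). \<exists>q'\<in>set (final M). run M q w q'}"

text \<open>
  Words are over an alphabet \<open>{..<k}\<close>. In a convolution, \<open>None\<close> is the blank symbol, and a tuple of
  letters is a list.
\<close>

definition conv :: "'l list list \<Rightarrow> 'l option list list" where
  "conv ws =
     map (\<lambda>j. map (\<lambda>w. if j < length w then Some (w ! j) else None) ws)
       [0..<Max (length ` set ws)]"

record presentation =
  alph :: nat
  autS :: "nat nfa"
  autP :: "nat nfa"
  autA :: "nat nfa"
  autDelta :: "nat option list nfa"
  autPlus :: "nat option list nfa"
  autR :: "nat option list nfa"

definition recognises ::
  "presentation \<Rightarrow> (nat list, nat list, nat list) rel_struct \<Rightarrow> bool" where
  "recognises p T \<longleftrightarrow>
     is_rel_struct T \<and>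
     US T \<subseteq> lists {..<alph p} \<and> UP T \<subseteq> lists {..<alph p} \<and> UA T \<subseteq> lists {..<alph p} \<and>
     lang (autS p) = US T \<and> lang (autP p) = UP T \<and> lang (autA p) = UA T \<and>
     lang (autDelta p) = {conv [s, a, t, x] | s a t x. (s, a, t, x) \<in> DeltaR T} \<and>
     lang (autPlus p) = {conv [x, y, z] | x y z. (x, y, z) \<in> PlusR T} \<and>
     lang (autR p) = {conv [s, t] | s t. (s, t) \<in> BinR T}"

definition regular_presentation ::
  "presentation \<Rightarrow> ('s, 'p, 'a) rel_struct \<Rightarrow> bool" where
  "regular_presentation p U \<longleftrightarrow> (\<exists>T. recognises p T \<and> isomorphic T U)"


section \<open>Computability\<close>

text \<open>
  \<open>recursive n f\<close>: on argument lists of length \<open>n\<close>, \<open>f\<close> is a total recursive function. The class is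
  generated from the initial functions by composition, primitive recursion and minimisation
  of regular functions. Values on lists of other lengths are irrelevant.
\<close>

inductive recursive :: "nat \<Rightarrow> (nat list \<Rightarrow> nat) \<Rightarrow> bool" where
  zero: "recursive n (\<lambda>xs. 0)"
| succ: "recursive 1 (\<lambda>xs. Suc (xs ! 0))"
| proj: "i < n \<Longrightarrow> recursive n (\<lambda>xs. xs ! i)"
| comp: "recursive (length fs) g \<Longrightarrow> \<forall>f\<in>set fs. recursive n f \<Longrightarrow>
    recursive n (\<lambda>xs. g (map (\<lambda>f. f xs) fs))"
| prim: "recursive n g \<Longrightarrow> recursive (Suc (Suc n)) h \<Longrightarrow>
    recursive (Suc n) (\<lambda>xs. rec_nat (g (tl xs)) (\<lambda>i r. h (i # r # tl xs)) (hd xs))"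
| mini: "recursive (Suc n) g \<Longrightarrow> \<forall>xs. length xs = n \<longrightarrow> (\<exists>y. g (y # xs) = 0) \<Longrightarrow>
    recursive n (\<lambda>xs. LEAST y. g (y # xs) = 0)"

primrec code_letter :: "nat option \<Rightarrow> nat" where
  "code_letter None = 0"
| "code_letter (Some c) = Suc c"

definition code_tuple :: "nat option list \<Rightarrow> nat" where
  "code_tuple x = list_encode (map code_letter x)"

definition code_nfa :: "('l \<Rightarrow> nat) \<Rightarrow> 'l nfa \<Rightarrow> nat" where
  "code_nfa c M =
     list_encode
       [list_encode (start M),
        list_encode (map (\<lambda>(q, x, r). list_encode [q, c x, r]) (steps M)),
        list_encode (final M)]"

definition code_presentation :: "presentation \<Rightarrow> nat" where
  "code_presentation p =
     list_encode
       [alph p,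
        code_nfa id (autS p), code_nfa id (autP p), code_nfa id (autA p),
        code_nfa code_tuple (autDelta p), code_nfa code_tuple (autPlus p),
        code_nfa code_tuple (autR p)]"

end

theory Submission
  imports Defs
begin

text \<open>
  Bisimilarity: by bounded branching, at most \<open>2 * b\<close> members of a class receive positive weight
  from one of two given configurations. The sentence guesses these members without repetition and
  compares two finite sums.

  Decidability: a relation that is first-order definable from automata is recognised by a
  deterministic automaton on convolutions, and a bound on its number of states is computable
  (product for conjunction, subset construction for the existential quantifier). The automaton need
  not be constructed: by pumping, a quantifier may be restricted to words that are longer than the
  words already chosen by at most the number of states, so a bounded search evaluates the sentence.
\<close>

text \<open>Infinite sums are not terms of the logic, but a sum of fixed length is. Since the number
  of relevant members varies, the sentence offers every length up to \<open>2 * b\<close>; it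
  depends on \<open>b\<close> alone, neither on the system nor on the relation. Decidability has to
  be uniform: one recursive function serves all presentations. Every predicate therefore takes the
  code of the presentation as an argument and comes with a single decision procedure and a single
  recursive bound on states. The bound is what carries the induction past a quantifier, because it
  turns the search for a word into a finite one. The automata themselves enter only existentially,
  so their transition functions and acceptance conditions may be arbitrary functions. What must be
  shown recursive is thus limited to simulating the given automata, searching finite lists and
  evaluating products and powers of bounds; a small calculus of computable functions on encoded
  types takes care of that.\<close>

section \<open>Recursive functions\<close>

text \<open>\<open>recursive\<close> constrains the values on lists of every length, \<open>rf\<close> only those of length \<open>n\<close>.\<close>

definition rf :: "nat \<Rightarrow> (nat list \<Rightarrow> nat) \<Rightarrow> bool" where
  "rf n f \<longleftrightarrow> (\<exists>g. recursive n g \<and> (\<forall>xs. length xs = n \<longrightarrow> g xs = f xs))"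

lemma rf_cong: "rf n g \<Longrightarrow> (\<And>xs. length xs = n \<Longrightarrow> f xs = g xs) \<Longrightarrow> rf n f"
  unfolding rf_def by auto

lemma rf_comp:
  assumes "rf (length fs) g" and "\<forall>f\<in>set fs. rf n f"
  shows "rf n (\<lambda>xs. g (map (\<lambda>f. f xs) fs))"
proof -
  obtain g' where g': "recursive (length fs) g'" "\<And>xs. length xs = length fs \<Longrightarrow> g' xs = g xs"
    using assms(1) unfolding rf_def by auto
  have "\<forall>f. \<exists>h. f \<in> set fs \<longrightarrow> recursive n h \<and> (\<forall>xs. length xs = n \<longrightarrow> h xs = f xs)"
    using assms(2) unfolding rf_def by blast
  then obtain c where c: "\<And>f. f \<in> set fs \<Longrightarrow>
      recursive n (c f) \<and> (\<forall>xs. length xs = n \<longrightarrow> c f xs = f xs)"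
    by metis
  have "recursive n (\<lambda>xs. g' (map (\<lambda>f. f xs) (map c fs)))"
    using g'(1) c by (intro recursive.comp) auto
  moreover have "g' (map (\<lambda>f. f xs) (map c fs)) = g (map (\<lambda>f. f xs) fs)" if "length xs = n" for xs
  proof -
    have "map (\<lambda>f. f xs) (map c fs) = map (\<lambda>f. f xs) fs"
      using c that by auto
    then show ?thesis using g'(2)[of "map (\<lambda>f. f xs) fs"] by (simp only: length_map)
  qed
  ultimately show ?thesis unfolding rf_def by blast
qed

lemma rf_nth: "i < n \<Longrightarrow> rf n (\<lambda>xs. xs ! i)"
  unfolding rf_def by (blast intro: recursive.proj)

lemma rf_comp1: "rf 1 (\<lambda>xs. F (xs ! 0)) \<Longrightarrow> rf n f \<Longrightarrow> rf n (\<lambda>xs. F (f xs))"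
  using rf_comp[of "[f]" "\<lambda>xs. F (xs ! 0)" n] by simp

lemma rf_Suc: "rf n f \<Longrightarrow> rf n (\<lambda>xs. Suc (f xs))"
  using rf_comp1[of Suc n f] recursive.succ unfolding rf_def by auto

lemma rf_const: "rf n (\<lambda>xs. c)"
proof (induction c)
  case 0
  show ?case unfolding rf_def using recursive.zero by auto
qed (rule rf_Suc)

text \<open>In a primitive recursion the counter and the previous value precede the parameters; this
  makes functions of the parameters available in the recursion step.\<close>

lemma rf_drop2:
  assumes "rf n f"
  shows "rf (Suc (Suc n)) (\<lambda>ys. f (drop 2 ys))"
proof -
  let ?fs = "map (\<lambda>i ys. ys ! Suc (Suc i)) [0..<n] :: (nat list \<Rightarrow> nat) list"
  have "rf (Suc (Suc n)) (\<lambda>ys. f (map (\<lambda>h. h ys) ?fs))"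
    using assms by (intro rf_comp) (auto intro: rf_nth)
  then show ?thesis
  proof (rule rf_cong)
    fix ys :: "nat list" assume "length ys = Suc (Suc n)"
    then have "drop 2 ys = map (\<lambda>h. h ys) ?fs"
      by (intro nth_equalityI) auto
    then show "f (drop 2 ys) = f (map (\<lambda>h. h ys) ?fs)" by simp
  qed
qed

text \<open>\<open>recursive.prim\<close> recurses on the first argument and passes on the rest.
  Feeding it \<open>m xs\<close> followed by all of \<open>xs\<close> gives recursion up to a
  computed bound.\<close>

lemma rf_rec:
  assumes a: "rf n a" and h: "rf (Suc (Suc n)) (\<lambda>ys. H (ys ! 0) (ys ! 1) (drop 2 ys))"
    and m: "rf n m"
  shows "rf n (\<lambda>xs. rec_nat (a xs) (\<lambda>i r. H i r xs) (m xs))"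
proof -
  obtain a' where a': "recursive n a'" "\<And>xs. length xs = n \<Longrightarrow> a' xs = a xs"
    using a unfolding rf_def by auto
  obtain h' where h': "recursive (Suc (Suc n)) h'"
      "\<And>ys. length ys = Suc (Suc n) \<Longrightarrow> h' ys = H (ys ! 0) (ys ! 1) (drop 2 ys)"
    using h unfolding rf_def by auto
  let ?p = "\<lambda>xs. rec_nat (a' (tl xs)) (\<lambda>i r. h' (i # r # tl xs)) (hd xs)"
  let ?fs = "m # map (\<lambda>i xs. xs ! i) [0..<n]"
  have "rf (Suc n) ?p"
    unfolding rf_def using recursive.prim[OF a'(1) h'(1)] by blast
  then have "rf n (\<lambda>xs. ?p (map (\<lambda>f. f xs) ?fs))"
    using m by (intro rf_comp) (auto intro: rf_nth)
  then show ?thesis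
  proof (rule rf_cong)
    fix xs :: "nat list" assume l: "length xs = n"
    have e: "map (\<lambda>f. f xs) ?fs = m xs # xs"
      using l by (auto intro!: nth_equalityI)
    have "rec_nat (a' xs) (\<lambda>i r. h' (i # r # xs)) k = rec_nat (a xs) (\<lambda>i r. H i r xs) k" for k
      using l by (induction k) (auto simp: a'(2) h'(2))
    then show "rec_nat (a xs) (\<lambda>i r. H i r xs) (m xs) = ?p (map (\<lambda>f. f xs) ?fs)"
      unfolding e by simp
  qed
qed

lemma rf_least:
  assumes h: "rf (Suc n) (\<lambda>ys. H (ys ! 0) (tl ys))"
    and ex: "\<And>xs. length xs = n \<Longrightarrow> \<exists>y. H y xs = 0"
  shows "rf n (\<lambda>xs. LEAST y. H y xs = 0)"
proof -
  obtain h' where h': "recursive (Suc n) h'"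
      "\<And>ys. length ys = Suc n \<Longrightarrow> h' ys = H (ys ! 0) (tl ys)"
    using h unfolding rf_def by auto
  have "recursive n (\<lambda>xs. LEAST y. h' (y # xs) = 0)"
    using h' ex by (intro recursive.mini) auto
  then show ?thesis unfolding rf_def using h' by fastforce
qed

section \<open>Arithmetic and the inverse of the pairing function\<close>

lemma rf_add: assumes "rf n f" "rf n g" shows "rf n (\<lambda>xs. f xs + g xs)"
proof -
  have "rf n (\<lambda>xs. rec_nat (f xs) (\<lambda>i r. Suc r) (g xs))"
    using assms by (intro rf_rec rf_Suc rf_nth) auto
  moreover have "rec_nat x (\<lambda>i r. Suc r) y = x + y" for x y by (induction y) auto
  ultimately show ?thesis by simp
qed

lemma rf_pred: assumes "rf n f" shows "rf n (\<lambda>xs. f xs - 1)"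
proof -
  have "rf n (\<lambda>xs. rec_nat 0 (\<lambda>i r. i) (f xs))"
    using assms by (intro rf_rec rf_const rf_nth) auto
  moreover have "rec_nat 0 (\<lambda>i r. i) y = y - 1" for y by (induction y) auto
  ultimately show ?thesis by simp
qed

lemma rf_diff: assumes "rf n f" "rf n g" shows "rf n (\<lambda>xs. f xs - g xs)"
proof -
  have "rf n (\<lambda>xs. rec_nat (f xs) (\<lambda>i r. r - 1) (g xs))"
    using assms by (intro rf_rec rf_pred rf_nth) auto
  moreover have "rec_nat x (\<lambda>i r. r - 1) y = x - y" for x y by (induction y) auto
  ultimately show ?thesis by simp
qed

text \<open>A recursion whose step ignores counter and previous value only distinguishes between no
  round and some round.\<close>

lemma rf_if0: assumes "rf n f" "rf n g" "rf n h" shows "rf n (\<lambda>xs. if f xs = 0 then g xs else h xs)"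
proof -
  have "rf n (\<lambda>xs. rec_nat (g xs) (\<lambda>i r. h xs) (f xs))"
    using assms by (intro rf_rec rf_drop2)
  moreover have "rec_nat x (\<lambda>i r. y) k = (if k = 0 then x else y)" for x y k :: nat
    by (cases k) auto
  ultimately show ?thesis by simp
qed

lemma rf_triangle: assumes "rf n f" shows "rf n (\<lambda>xs. triangle (f xs))"
proof -
  have "rf n (\<lambda>xs. rec_nat 0 (\<lambda>i r. r + Suc i) (f xs))"
    using assms by (intro rf_rec rf_const rf_add rf_Suc rf_nth) auto
  moreover have "rec_nat 0 (\<lambda>i r. r + Suc i) y = triangle y" for y by (induction y) auto
  ultimately show ?thesis by simp
qed

text \<open>\<open>prod_encode (a, b)\<close> is \<open>triangle (a + b) + a\<close>, and this
  recovers the diagonal \<open>a + b\<close>: the least \<open>k\<close> with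
  \<open>z < triangle (Suc k)\<close>. The inequality is written as a vanishing truncated difference
  because minimisation searches for a zero.\<close>

definition tri_root :: "nat \<Rightarrow> nat" where
  "tri_root z = (LEAST k. Suc z - triangle (Suc k) = 0)"

lemma le_triangle: "n \<le> triangle n"
  by (induction n) auto

lemma triangle_mono: "m \<le> n \<Longrightarrow> triangle m \<le> triangle n"
  by (induction n) (auto simp: le_Suc_eq)

lemma tri_root_prod_encode: "tri_root (prod_encode (a, b)) = a + b"
  unfolding tri_root_def
proof (rule Least_equality)
  fix k assume k: "Suc (prod_encode (a, b)) - triangle (Suc k) = 0"
  show "a + b \<le> k"
  proof (rule ccontr)
    assume "\<not> a + b \<le> k"
    then have "triangle (Suc k) \<le> triangle (a + b)" by (intro triangle_mono) simp
    with k show False by (simp add: prod_encode_def)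
  qed
qed (simp add: prod_encode_def)

lemma rf_tri_root: "rf n f \<Longrightarrow> rf n (\<lambda>xs. tri_root (f xs))"
proof (rule rf_comp1[where F = tri_root])
  show "rf 1 (\<lambda>xs. tri_root (xs ! 0))"
    unfolding tri_root_def
  proof (rule rf_least)
    have "rf (Suc 1) (\<lambda>ys. Suc (ys ! 1) - triangle (Suc (ys ! 0)))"
      by (intro rf_diff rf_Suc rf_triangle rf_nth) auto
    then show "rf (Suc 1) (\<lambda>ys. Suc (tl ys ! 0) - triangle (Suc (ys ! 0)))"
      by (rule rf_cong) (simp add: nth_tl)
    show "\<exists>y. Suc (xs ! 0) - triangle (Suc y) = 0" for xs :: "nat list"
      using le_triangle[of "Suc (xs ! 0)"] by (intro exI[of _ "xs ! 0"]) simp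
  qed
qed

lemma rf_prod_encode: "rf n f \<Longrightarrow> rf n g \<Longrightarrow> rf n (\<lambda>xs. prod_encode (f xs, g xs))"
  unfolding prod_encode_def by (simp add: rf_add rf_triangle)

lemma fst_prod_decode: "fst (prod_decode z) = z - triangle (tri_root z)"
proof -
  obtain a b where "z = prod_encode (a, b)" by (metis prod_decode_inverse surj_pair)
  then show ?thesis by (simp add: tri_root_prod_encode) (simp add: prod_encode_def)
qed

lemma snd_prod_decode: "snd (prod_decode z) = tri_root z - fst (prod_decode z)"
proof -
  obtain a b where "z = prod_encode (a, b)" by (metis prod_decode_inverse surj_pair)
  then show ?thesis by (simp add: tri_root_prod_encode)
qed

lemma rf_fst_prod_decode: "rf n f \<Longrightarrow> rf n (\<lambda>xs. fst (prod_decode (f xs)))"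
  unfolding fst_prod_decode by (intro rf_diff rf_triangle rf_tri_root)

lemma rf_snd_prod_decode: "rf n f \<Longrightarrow> rf n (\<lambda>xs. snd (prod_decode (f xs)))"
  unfolding snd_prod_decode by (intro rf_diff rf_fst_prod_decode rf_tri_root)


section \<open>Computable functions between encoded types\<close>

text \<open>Only injectivity is required, so that equality can be tested on codes;
  \<open>bool\<close> already has numbers that are no codes.\<close>

class enc =
  fixes enc :: "'a \<Rightarrow> nat"
  assumes enc_inject: "enc x = enc y \<Longrightarrow> x = y"

lemma enc_eq_iff [simp]: "enc x = enc y \<longleftrightarrow> x = y"
  using enc_inject by blast

instantiation nat :: enc
begin
definition enc_nat :: "nat \<Rightarrow> nat" where [simp]: "enc_nat n = n"
instance by standard simp
end

instantiation bool :: enc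
begin
definition enc_bool :: "bool \<Rightarrow> nat" where [simp]: "enc_bool b = of_bool b"
instance by standard (simp add: of_bool_def split: if_splits)
end

instantiation prod :: (enc, enc) enc
begin
definition enc_prod :: "'a \<times> 'b \<Rightarrow> nat" where "enc_prod p = prod_encode (enc (fst p), enc (snd p))"
instance by standard (simp add: enc_prod_def prod_eq_iff)
end

instantiation list :: (enc) enc
begin
definition enc_list :: "'a list \<Rightarrow> nat" where "enc_list xs = list_encode (map enc xs)"
instance
proof
  fix xs ys :: "'a list"
  assume "enc xs = enc ys"
  then have "map enc xs = map enc ys" by (simp add: enc_list_def list_encode_eq)
  then show "xs = ys" by (rule map_injective) (auto simp: inj_def intro: enc_inject)
qed
end

lemma enc_Pair [simp]: "enc (x, y) = prod_encode (enc x, enc y)"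
  by (simp add: enc_prod_def)

lemma enc_Nil [simp]: "enc [] = 0"
  by (simp add: enc_list_def)

lemma enc_Cons [simp]: "enc (x # xs) = Suc (prod_encode (enc x, enc xs))"
  by (simp add: enc_list_def)

text \<open>On the level of codes, \<open>list_encode\<close> and \<open>list_decode\<close> thereby
  become the identity, which makes them computable.\<close>

lemma enc_nat_list: "enc (xs :: nat list) = list_encode xs"
  by (simp add: enc_list_def id_def[symmetric] enc_nat_def[abs_def])

text \<open>The realizer \<open>g\<close> is unconstrained at numbers that are no codes. Most rules
  below speak of functions of an environment \<open>e\<close>, so that \<open>comp_intros\<close>
  can follow the syntax of a term; functions of several arguments are passed in uncurried
  form.\<close>

definition computable :: "('a::enc \<Rightarrow> 'b::enc) \<Rightarrow> bool" where
  "computable f \<longleftrightarrow> (\<exists>g. rf 1 (\<lambda>xs. g (xs ! 0)) \<and> (\<forall>x. g (enc x) = enc (f x)))"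

named_theorems comp_intros

lemma computableI: "rf 1 (\<lambda>xs. g (xs ! 0)) \<Longrightarrow> (\<And>x. g (enc x) = enc (f x)) \<Longrightarrow> computable f"
  unfolding computable_def by blast

text \<open>In this form the realizer can be inserted into recursive functions of any arity.\<close>

lemma computableD:
  assumes "computable f"
  shows "\<exists>g. (\<forall>n h. rf n h \<longrightarrow> rf n (\<lambda>xs. g (h xs))) \<and> (\<forall>x. g (enc x) = enc (f x))"
proof -
  obtain g where g: "rf 1 (\<lambda>xs. g (xs ! 0))" "\<forall>x. g (enc x) = enc (f x)"
    using assms unfolding computable_def by blast
  then show ?thesis using rf_comp1[of g] by blast
qed

lemma comp_id: "computable (\<lambda>e. e)"
  by (rule computableI[of "\<lambda>x. x"]) (auto intro: rf_nth)

lemma comp_const: "computable (\<lambda>e. c)"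
  by (rule computableI[of "\<lambda>x. enc c"]) (auto intro: rf_const)

lemma comp_compose:
  assumes "computable F" "computable f" shows "computable (\<lambda>e. F (f e))"
proof -
  obtain g h where g: "\<And>n h. rf n h \<Longrightarrow> rf n (\<lambda>xs. g (h xs))" "\<And>x. g (enc x) = enc (F x)"
    and h: "\<And>n k. rf n k \<Longrightarrow> rf n (\<lambda>xs. h (k xs))" "\<And>x. h (enc x) = enc (f x)"
    using computableD[OF assms(1)] computableD[OF assms(2)] by blast
  show ?thesis
    by (rule computableI[of "\<lambda>x. g (h x)"]) (auto simp: g(2) h(2) intro!: g(1) h(1) rf_nth)
qed

lemma comp_lift1:
  assumes "\<And>n h. rf n h \<Longrightarrow> rf n (\<lambda>xs. G (h xs))" "\<And>x. G (enc x) = enc (F x)"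
  shows "computable f \<Longrightarrow> computable (\<lambda>e. F (f e))"
  using comp_compose[of F f] computableI[of G F] assms by (simp add: rf_nth)

lemma comp_lift2:
  assumes G: "\<And>n g h. rf n g \<Longrightarrow> rf n h \<Longrightarrow> rf n (\<lambda>xs. G (g xs) (h xs))"
    "\<And>x y. G (enc x) (enc y) = enc (F x y)"
    and "computable f" "computable f'"
  shows "computable (\<lambda>e. F (f e) (f' e))"
proof -
  obtain g h where g: "\<And>n h. rf n h \<Longrightarrow> rf n (\<lambda>xs. g (h xs))" "\<And>x. g (enc x) = enc (f x)"
    and h: "\<And>n k. rf n k \<Longrightarrow> rf n (\<lambda>xs. h (k xs))" "\<And>x. h (enc x) = enc (f' x)"
    using computableD[OF assms(3)] computableD[OF assms(4)] by blast
  show ?thesis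
    by (rule computableI[of "\<lambda>x. G (g x) (h x)"])
      (auto simp: g(2) h(2) G(2) intro!: G(1) g(1) h(1) rf_nth)
qed

lemma comp_Pair [comp_intros]:
  "computable f \<Longrightarrow> computable g \<Longrightarrow> computable (\<lambda>e. (f e, g e))"
  by (rule comp_lift2[of "\<lambda>x y. prod_encode (x, y)"]) (auto intro: rf_prod_encode)

lemma comp_fst [comp_intros]: "computable f \<Longrightarrow> computable (\<lambda>e. fst (f e))"
  by (rule comp_lift1[of "\<lambda>x. fst (prod_decode x)"])
    (auto intro: rf_fst_prod_decode simp: enc_prod_def)

lemma comp_snd [comp_intros]: "computable f \<Longrightarrow> computable (\<lambda>e. snd (f e))"
  by (rule comp_lift1[of "\<lambda>x. snd (prod_decode x)"])
    (auto intro: rf_snd_prod_decode simp: enc_prod_def)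

lemma comp_Suc [comp_intros]: "computable f \<Longrightarrow> computable (\<lambda>e. Suc (f e))"
  by (rule comp_lift1[of Suc]) (auto intro: rf_Suc)

lemma comp_add [comp_intros]:
  fixes f g :: "'a::enc \<Rightarrow> nat"
  shows "computable f \<Longrightarrow> computable g \<Longrightarrow> computable (\<lambda>e. f e + g e)"
  by (rule comp_lift2[of "(+)"]) (auto intro: rf_add)

lemma comp_diff [comp_intros]:
  fixes f g :: "'a::enc \<Rightarrow> nat"
  shows "computable f \<Longrightarrow> computable g \<Longrightarrow> computable (\<lambda>e. f e - g e)"
  by (rule comp_lift2[of "(-)"]) (auto intro: rf_diff)

lemma comp_enc [comp_intros]: "computable f \<Longrightarrow> computable (\<lambda>e. enc (f e))"
  by (rule comp_lift1[of "\<lambda>x. x"]) auto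

lemma comp_list_decode [comp_intros]: "computable f \<Longrightarrow> computable (\<lambda>e. list_decode (f e))"
  by (rule comp_lift1[of "\<lambda>x. x"]) (auto simp: enc_nat_list)

lemma comp_if [comp_intros]:
  assumes "computable b" "computable f" "computable g"
  shows "computable (\<lambda>e. if b e then f e else g e)"
proof -
  obtain b' f' g' where b': "\<And>n h. rf n h \<Longrightarrow> rf n (\<lambda>xs. b' (h xs))" "\<And>x. b' (enc x) = enc (b x)"
    and f': "\<And>n h. rf n h \<Longrightarrow> rf n (\<lambda>xs. f' (h xs))" "\<And>x. f' (enc x) = enc (f x)"
    and g': "\<And>n h. rf n h \<Longrightarrow> rf n (\<lambda>xs. g' (h xs))" "\<And>x. g' (enc x) = enc (g x)"
    using computableD[OF assms(1)] computableD[OF assms(2)] computableD[OF assms(3)] by blast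
  show ?thesis
    by (rule computableI[of "\<lambda>x. if b' x = 0 then g' x else f' x"])
      (auto simp: b'(2) f'(2) g'(2) intro!: rf_if0 b'(1) f'(1) g'(1) rf_nth)
qed

lemma comp_eq0: "computable f \<Longrightarrow> computable (\<lambda>e. f e = (0::nat))"
  by (rule comp_lift1[of "\<lambda>x. if x = 0 then 1 else 0"]) (auto intro!: rf_if0 rf_const)

lemma comp_eq [comp_intros]:
  assumes "computable f" "computable g"
  shows "computable (\<lambda>e. f e = g e)"
proof -
  have "f e = g e \<longleftrightarrow> (enc (f e) - enc (g e)) + (enc (g e) - enc (f e)) = 0" for e
    by (metis add_is_0 diff_is_0_eq enc_eq_iff le_antisym le_refl)
  then show ?thesis using assms by (simp only:) (intro comp_eq0 comp_intros)
qed

lemma comp_not [comp_intros]: "computable b \<Longrightarrow> computable (\<lambda>e. \<not> b e)"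
  using comp_if[of b "\<lambda>e. False" "\<lambda>e. True"] by (simp add: comp_const if_bool_eq_conj)

lemma comp_conj [comp_intros]:
  assumes "computable b" "computable c" shows "computable (\<lambda>e. b e \<and> c e)"
proof -
  have "(\<lambda>e. b e \<and> c e) = (\<lambda>e. if b e then c e else False)" by auto
  then show ?thesis using assms by (simp only:) (intro comp_if comp_const)
qed

text \<open>The intermediate values are carried as codes, so the recursion may produce values of any
  encoded type, such as pairs and lists.\<close>

lemma comp_rec_nat [comp_intros]:
  assumes a: "computable a" and h: "computable (\<lambda>p. h (fst p) (fst (snd p)) (snd (snd p)))"
    and m: "computable m"
  shows "computable (\<lambda>e. rec_nat (a e) (h e) (m e))"
proof -
  obtain a' where a': "\<And>n h. rf n h \<Longrightarrow> rf n (\<lambda>xs. a' (h xs))" "\<And>x. a' (enc x) = enc (a x)"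
    using computableD[OF a] by blast
  obtain h' where h': "\<And>n f. rf n f \<Longrightarrow> rf n (\<lambda>xs. h' (f xs))"
      "\<And>x. h' (enc x) = enc (h (fst x) (fst (snd x)) (snd (snd x)))"
    using computableD[OF h] by blast 
  obtain m' where m': "\<And>n h. rf n h \<Longrightarrow> rf n (\<lambda>xs. m' (h xs))" "\<And>x. m' (enc x) = enc (m x)"
    using computableD[OF m] by blast
  show ?thesis
  proof (rule computableI)
    have "rf 1 (\<lambda>xs. rec_nat (a' (xs ! 0))
        (\<lambda>i r. h' (prod_encode (xs ! 0, prod_encode (i, r)))) (m' (xs ! 0)))"
      by (intro rf_rec h'(1) rf_prod_encode a'(1) m'(1) rf_nth rf_drop2) auto
    then show "rf 1 (\<lambda>xs. (\<lambda>z. rec_nat (a' z)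
        (\<lambda>i r. h' (prod_encode (z, prod_encode (i, r)))) (m' z)) (xs ! 0))"
      by simp
  next
    fix x
    have "rec_nat (a' (enc x)) (\<lambda>i r. h' (prod_encode (enc x, prod_encode (i, r)))) k
        = enc (rec_nat (a x) (h x) k)" for k
    proof (induction k)
      case (Suc k)
      show ?case using h'(2)[of "(x, k, rec_nat (a x) (h x) k)"] Suc by simp
    qed (simp add: a'(2))
    then show "rec_nat (a' (enc x)) (\<lambda>i r. h' (prod_encode (enc x, prod_encode (i, r))))
        (m' (enc x)) = enc (rec_nat (a x) (h x) (m x))"
      by (simp add: m'(2))
  qed
qed

section \<open>Computable operations on lists and further arithmetic\<close>

lemma comp_Cons [comp_intros]:
  "computable f \<Longrightarrow> computable g \<Longrightarrow> computable (\<lambda>e. f e # g e)"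
  by (rule comp_lift2[of "\<lambda>x y. Suc (prod_encode (x, y))"]) (auto intro!: rf_Suc rf_prod_encode)

lemma comp_hd [comp_intros]:
  fixes f :: "'a::enc \<Rightarrow> 'b::enc list"
  assumes "computable f"
  shows "computable (\<lambda>e. hd (f e))"
proof (rule comp_lift1[OF _ _ assms])
  \<comment> \<open>\<open>hd []\<close> is unspecified but fixed, so its code is a constant that
    the realizer may contain.\<close>
  let ?G = "\<lambda>z. if z = 0 then enc (hd [] :: 'b) else fst (prod_decode (z - 1))"
  show "rf n (\<lambda>xs. ?G (h xs))" if "rf n h" for n h
    by (intro rf_if0 rf_const rf_fst_prod_decode rf_pred that)
  show "?G (enc x) = enc (hd x)" for x :: "'b list"
    by (cases x) auto
qed

lemma comp_tl [comp_intros]: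
  assumes "computable f"
  shows "computable (\<lambda>e. tl (f e))"
proof (rule comp_lift1[OF _ _ assms])
  let ?G = "\<lambda>z. if z = 0 then 0 else snd (prod_decode (z - 1))"
  show "rf n (\<lambda>xs. ?G (h xs))" if "rf n h" for n h
    by (intro rf_if0 rf_const rf_snd_prod_decode rf_pred that)
  show "?G (enc x) = enc (tl x)" for x :: "'b list"
    by (cases x) auto
qed

text \<open>The recursion runs as often as the code of the list says, which is at least its length.\<close>

lemma comp_foldl [comp_intros]:
  fixes h :: "'a::enc \<Rightarrow> 'b::enc \<Rightarrow> 'c::enc \<Rightarrow> 'b"
  assumes h: "computable (\<lambda>p. h (fst p) (fst (snd p)) (snd (snd p)))"
    and a: "computable a" and l: "computable l"
  shows "computable (\<lambda>e. foldl (h e) (a e) (l e))"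
proof -
  \<comment> \<open>The state is the accumulator with the rest of the list. Once the list is
    exhausted the state no longer changes, so surplus rounds do no harm.\<close>
  define st where "st e (q :: 'b \<times> 'c list) =
      (if snd q = [] then q else (h e (fst q) (hd (snd q)), tl (snd q)))" for e q
  have h': "computable (\<lambda>e. h (x e) (y e) (z e))"
    if "computable x" "computable y" "computable z" for x y z
    using comp_compose[OF h, of "\<lambda>e. (x e, y e, z e)"] that by (simp add: comp_Pair)
  have "computable (\<lambda>e. fst (rec_nat (a e, l e) (\<lambda>i. st e) (enc (l e))))"
    unfolding st_def by (intro comp_intros a l h' comp_id comp_const)
  moreover have "fst (rec_nat (a e, l e) (\<lambda>i. st e) (enc (l e))) = foldl (h e) (a e) (l e)" for e
  proof -
    \<comment> \<open>\<open>rec_nat\<close> unfolds its last round, whereas the list is consumed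
      from the front.\<close>
    have shift: "rec_nat q (\<lambda>i. st e) (Suc n) = rec_nat (st e q) (\<lambda>i. st e) n" for q n
      by (induction n) auto
    have "length xs \<le> n \<Longrightarrow> rec_nat (x, xs) (\<lambda>i. st e) n = (foldl (h e) x xs, [])" for n x xs
    proof (induction xs arbitrary: x n)
      case Nil
      show ?case by (induction n) (auto simp: st_def)
    next
      case (Cons y ys)
      then obtain m where m: "n = Suc m" by (cases n) auto
      have "rec_nat (x, y # ys) (\<lambda>i. st e) n = rec_nat (h e x y, ys) (\<lambda>i. st e) m"
        unfolding m shift by (simp add: st_def)
      then show ?case using Cons m by simp
    qed
    moreover have "length xs \<le> enc xs" for xs :: "'c list"
    proof (induction xs)
      case (Cons x xs)
      then show ?case using le_prod_encode_2[of "enc xs" "enc x"] by simp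
    qed simp
    ultimately show ?thesis by simp
  qed
  ultimately show ?thesis by simp
qed

lemma comp_compose2:
  assumes "computable (\<lambda>p. F (fst p) (snd p))" "computable f" "computable g"
  shows "computable (\<lambda>e. F (f e) (g e))"
  using comp_compose[OF assms(1), of "\<lambda>e. (f e, g e)"] assms(2,3) by (simp add: comp_Pair)

lemma comp_rev [comp_intros]:
  fixes f :: "'a::enc \<Rightarrow> 'b::enc list"
  assumes "computable f"
  shows "computable (\<lambda>e. rev (f e))"
proof -
  have "rev xs = foldl (\<lambda>a x. x # a) [] xs" for xs :: "'b list"
    by (induction xs rule: rev_induct) auto
  then show ?thesis
    by (simp only:) (intro comp_intros comp_const comp_id assms)
qed

lemma comp_append [comp_intros]:
  fixes f g :: "'a::enc \<Rightarrow> 'b::enc list"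
  assumes "computable f" "computable g"
  shows "computable (\<lambda>e. f e @ g e)"
proof -
  have "xs @ ys = foldl (\<lambda>a x. x # a) ys (rev xs)" for xs ys :: "'b list"
    by (induction xs) auto
  then show ?thesis
    by (simp only:) (intro comp_intros comp_const comp_id assms)
qed

lemma comp_map [comp_intros]:
  assumes F: "computable (\<lambda>p. F (fst p) (snd p))" and l: "computable l"
  shows "computable (\<lambda>e. map (F e) (l e))"
proof -
  have "map (F e) xs = rev (foldl (\<lambda>a x. F e x # a) [] xs)" for e xs
    by (induction xs rule: rev_induct) auto
  then show ?thesis
    by (simp only:) (intro comp_intros comp_const comp_id l comp_compose2[OF F])
qed

lemma comp_filter [comp_intros]:
  assumes F: "computable (\<lambda>p. F (fst p) (snd p))" and l: "computable l"
  shows "computable (\<lambda>e. filter (F e) (l e))"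
proof -
  have "filter (F e) xs = rev (foldl (\<lambda>a x. if F e x then x # a else a) [] xs)" for e xs
    by (induction xs rule: rev_induct) auto
  then show ?thesis
    by (simp only:) (intro comp_intros comp_const comp_id l comp_compose2[OF F])
qed

lemma comp_concat [comp_intros]:
  fixes f :: "'a::enc \<Rightarrow> 'b::enc list list"
  assumes "computable f"
  shows "computable (\<lambda>e. concat (f e))"
proof -
  have "concat xs = foldl (\<lambda>a x. a @ x) [] xs" for xs :: "'b list list"
    by (induction xs rule: rev_induct) auto
  then show ?thesis
    by (simp only:) (intro comp_intros comp_const comp_id assms)
qed

lemma comp_bex [comp_intros]:
  assumes F: "computable (\<lambda>p. F (fst p) (snd p))" and l: "computable l"
  shows "computable (\<lambda>e. \<exists>x\<in>set (l e). F e x)"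
proof -
  have "(\<exists>x\<in>set xs. F e x) = foldl (\<lambda>a x. if F e x then True else a) False xs" for e xs
    by (induction xs rule: rev_induct) auto
  then show ?thesis
    by (simp only:) (intro comp_intros comp_const comp_id l comp_compose2[OF F])
qed

lemma comp_member [comp_intros]:
  assumes "computable f" "computable g"
  shows "computable (\<lambda>e. f e \<in> set (g e))"
proof -
  have "computable (\<lambda>e. \<exists>x\<in>set (g e). x = f e)"
    by (intro comp_intros assms comp_id comp_compose[OF assms(1)])
  then show ?thesis by simp
qed

lemma comp_length [comp_intros]:
  fixes f :: "'a::enc \<Rightarrow> 'b::enc list"
  assumes "computable f"
  shows "computable (\<lambda>e. length (f e))"
proof -
  have "length xs = foldl (\<lambda>a x. Suc a) 0 xs" for xs :: "'b list"
    by (induction xs rule: rev_induct) auto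
  then show ?thesis
    by (simp only:) (intro comp_intros comp_const comp_id assms)
qed

lemma comp_upt0 [comp_intros]:
  assumes "computable f"
  shows "computable (\<lambda>e. [0..<f e])"
proof -
  have "[0..<n] = rec_nat [] (\<lambda>i r. r @ [i]) n" for n
    by (induction n) auto
  then show ?thesis
    by (simp only:) (intro comp_intros comp_const comp_id assms)
qed

lemma comp_drop [comp_intros]:
  fixes g :: "'a::enc \<Rightarrow> 'b::enc list"
  assumes "computable f" "computable g"
  shows "computable (\<lambda>e. drop (f e) (g e))"
proof -
  have "drop n xs = rec_nat xs (\<lambda>i r. tl r) n" for n and xs :: "'b list"
    by (induction n) (auto simp: drop_Suc tl_drop[symmetric])
  then show ?thesis
    by (simp only:) (intro comp_intros comp_const comp_id assms)
qed

lemma comp_max [comp_intros]: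
  fixes f g :: "'a::enc \<Rightarrow> nat"
  assumes "computable f" "computable g"
  shows "computable (\<lambda>e. max (f e) (g e))"
proof -
  have "max x y = y + (x - y)" for x y :: nat by simp
  then show ?thesis
    by (simp only:) (intro comp_intros assms)
qed

lemma comp_mult [comp_intros]:
  fixes f g :: "'a::enc \<Rightarrow> nat"
  assumes "computable f" "computable g"
  shows "computable (\<lambda>e. f e * g e)"
proof -
  have "x * y = rec_nat 0 (\<lambda>i r. r + x) y" for x y by (induction y) auto
  then show ?thesis
    by (simp only:) (intro comp_intros comp_const comp_id assms comp_compose[OF assms(1)])
qed

lemma comp_power2 [comp_intros]:
  fixes f :: "'a::enc \<Rightarrow> nat"
  assumes "computable f"
  shows "computable (\<lambda>e. 2 ^ f e :: nat)"
proof -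
  have "(2::nat) ^ n = rec_nat 1 (\<lambda>i r. r + r) n" for n by (induction n) auto
  then show ?thesis
    by (simp only:) (intro comp_intros comp_const comp_id assms)
qed

section \<open>Convolutions and coded automata\<close>

text \<open>The letter at position \<open>j\<close> as \<open>code_letter\<close> codes it in a
  convolution. It is expressed by \<open>drop\<close> and \<open>hd\<close>, for which computability
  rules are available.\<close>

definition digit :: "nat \<Rightarrow> nat list \<Rightarrow> nat" where
  "digit j w = (if drop j w = [] then 0 else Suc (hd (drop j w)))"

text \<open>A fold is computable, and it is 0 for the empty list, where the \<open>Max\<close> in
  \<open>conv\<close> is unspecified; hence the nonemptiness assumptions when \<open>cols\<close> is
  compared with \<open>conv\<close>.\<close>

definition maxlen :: "nat list list \<Rightarrow> nat" where
  "maxlen ws = foldl (\<lambda>m w. max m (length w)) 0 ws"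

text \<open>The columns of the convolution, with 0 as the blank symbol.\<close>

definition cols :: "nat list list \<Rightarrow> nat list list" where
  "cols ws = map (\<lambda>j. map (\<lambda>w. digit j w) ws) [0..<maxlen ws]"

definition words :: "nat \<Rightarrow> nat \<Rightarrow> nat list list" where
  "words k m = rec_nat [[]]
     (\<lambda>i r. [] # concat (map (\<lambda>w. map (\<lambda>x. x # w) [0..<k]) r)) m"

text \<open>The components of a number of the form \<open>code_nfa c M\<close>. Any other number
  also denotes some automaton in this way, so the results on \<open>accepts\<close> can be stated
  for all numbers.\<close>

definition nst :: "nat \<Rightarrow> nat list" where
  "nst M = list_decode (hd (list_decode M))"

definition nsteps :: "nat \<Rightarrow> nat list" where
  "nsteps M = list_decode (hd (tl (list_decode M)))"

definition nfin :: "nat \<Rightarrow> nat list" where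
  "nfin M = list_decode (hd (tl (tl (list_decode M))))"

text \<open>The subset construction carried out along the input, with lists for sets. An entry of
  \<open>nsteps M\<close> codes source, letter and target in this order.\<close>

definition nstep :: "nat \<Rightarrow> nat list \<Rightarrow> nat \<Rightarrow> nat list" where
  "nstep M S x =
     map (\<lambda>s. hd (tl (tl (list_decode s))))
       (filter (\<lambda>s. hd (list_decode s) \<in> set S \<and> hd (tl (list_decode s)) = x) (nsteps M))"

definition accepts :: "nat \<Rightarrow> nat list \<Rightarrow> bool" where
  "accepts M w \<longleftrightarrow> (\<exists>q\<in>set (foldl (nstep M) (nst M) w). q \<in> set (nfin M))"

lemma comp_cols [comp_intros]:
  assumes "computable f"
  shows "computable (\<lambda>e. cols (f e))"
  unfolding cols_def digit_def maxlen_def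
  by (intro comp_intros comp_const comp_id assms comp_compose[OF assms(1)])

lemma comp_maxlen [comp_intros]:
  assumes "computable f"
  shows "computable (\<lambda>e. maxlen (f e))"
  unfolding maxlen_def by (intro comp_intros comp_const comp_id assms)

lemma comp_words [comp_intros]:
  assumes "computable f" "computable g"
  shows "computable (\<lambda>e. words (f e) (g e))"
  unfolding words_def
  by (intro comp_intros comp_const comp_id assms comp_compose[OF assms(1)])

lemma comp_accepts [comp_intros]:
  assumes "computable f" "computable g"
  shows "computable (\<lambda>e. accepts (f e) (g e))"
  unfolding accepts_def nstep_def nst_def nsteps_def nfin_def
  by (intro comp_intros comp_const comp_id assms comp_compose[OF assms(1)])

lemma set_words: "set (words k m) = {w \<in> lists {..<k}. length w \<le> m}"
proof (induction m)
  case (Suc m)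
  have "w \<in> set (words k (Suc m)) \<longleftrightarrow> w \<in> lists {..<k} \<and> length w \<le> Suc m" for w
  proof -
    have "set (words k (Suc m)) = insert [] (\<Union>w\<in>set (words k m). (\<lambda>x. x # w) ` {..<k})"
      by (auto simp: words_def)
    then show ?thesis unfolding Suc by (cases w) auto
  qed
  then show ?case by auto
qed (auto simp: words_def)

section \<open>Columns determine the words, and coded automata have the right language\<close>

lemma digit_eq: "digit j w = (if j < length w then Suc (w ! j) else 0)"
  by (auto simp: digit_def hd_drop_conv_nth)

lemma maxlen_Nil [simp]: "maxlen [] = 0"
  by (simp add: maxlen_def)

lemma maxlen_Cons [simp]: "maxlen (w # ws) = max (length w) (maxlen ws)"
proof -
  have *: "foldl (\<lambda>m w. max m (length w)) x ws = max x (maxlen ws)" for x :: nat and ws :: "nat list list"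
    unfolding maxlen_def
  proof (induction ws arbitrary: x)
    case (Cons a ws)
    have "foldl (\<lambda>m w. max m (length w)) x (a # ws) = max (max x (length a)) (foldl (\<lambda>m w. max m (length w)) 0 ws)"
      unfolding foldl_Cons by (rule Cons)
    also have "\<dots> = max x (foldl (\<lambda>m w. max m (length w)) (max 0 (length a)) ws)"
      unfolding Cons[of "max 0 (length a)"] by (simp add: max.assoc)
    finally show ?case by simp
  qed simp
  show ?thesis using *[of "length w" ws] by (simp add: maxlen_def)
qed

lemma less_maxlen: "j < maxlen ws \<longleftrightarrow> (\<exists>w\<in>set ws. j < length w)"
  by (induction ws) (auto simp: less_max_iff_disj)

lemma maxlen_Max: "ws \<noteq> [] \<Longrightarrow> maxlen ws = Max (length ` set ws)"
  by (induction ws rule: induct_list012) auto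

lemma length_cols [simp]: "length (cols ws) = maxlen ws"
  by (simp add: cols_def)

lemma nth_cols: "j < maxlen ws \<Longrightarrow> i < length ws \<Longrightarrow> cols ws ! j ! i = digit j (ws ! i)"
  by (simp add: cols_def)

lemma cols_conv: "ws \<noteq> [] \<Longrightarrow> cols ws = map (map code_letter) (conv ws)"
  by (auto simp: cols_def conv_def maxlen_Max digit_eq)

lemma digit_inject:
  assumes "\<And>j. j < max (length u) (length v) \<Longrightarrow> digit j u = digit j v"
  shows "u = v"
proof (rule nth_equalityI)
  show l: "length u = length v"
  proof (rule ccontr)
    assume "length u \<noteq> length v"
    then consider "length u < length v" | "length v < length u" by linarith
    then show False
      \<comment> \<open>At the end of the shorter word one digit is the blank 0 and the other is a
        successor.\<close>
      using assms[of "length u"] assms[of "length v"] by cases (simp_all add: digit_eq)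
  qed
  show "u ! i = v ! i" if "i < length u" for i
    using assms[of i] that l by (simp add: digit_eq)
qed

text \<open>Each word can be read off its own track. This is what makes acceptance of a convolution
  equivalent to membership of the tuple in the relation.\<close>

lemma cols_inject:
  assumes "length us = length vs" "cols us = cols vs"
  shows "us = vs"
proof (rule nth_equalityI)
  fix i assume i: "i < length us"
  have m: "maxlen us = maxlen vs" using assms(2) by (metis length_cols)
  show "us ! i = vs ! i"
  proof (rule digit_inject)
    fix j assume "j < max (length (us ! i)) (length (vs ! i))"
    then have "j < maxlen us"
      using i assms(1) nth_mem[of i us] nth_mem[of i vs] m less_maxlen
      by (metis less_max_iff_disj)
    then show "digit j (us ! i) = digit j (vs ! i)"
      using nth_cols[of j us i] nth_cols[of j vs i] i assms m by simp
  qed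
qed (rule assms)

text \<open>The simulation compares letters by their codes; injectivity of \<open>c\<close> keeps it
  from confusing two of them.\<close>

lemma accepts_code_nfa:
  assumes "inj c"
  shows "accepts (code_nfa c M) (map c w) \<longleftrightarrow> w \<in> lang M"
proof -
  have step: "set (nstep (code_nfa c M) S (c x)) = {r. \<exists>q\<in>set S. (q, x, r) \<in> set (steps M)}" for S x
    using assms by (force simp: nstep_def nsteps_def code_nfa_def inj_eq)
  have "set (foldl (nstep (code_nfa c M)) S (map c w)) = {r. \<exists>q\<in>set S. run M q w r}" for S
  proof (induction w arbitrary: S)
    case (Cons x w)
    show ?case by (simp add: Cons step) blast
  qed auto
  then show ?thesis
    by (auto simp: accepts_def lang_def nst_def nfin_def) (auto simp: code_nfa_def)
qed

section \<open>Uniformly automatic predicates\<close>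

text \<open>A deterministic automaton with states below \<open>B\<close>. Its transitions are
  defined on all columns whatsoever, so the size of the alphabet never enters the bound.\<close>

definition recog :: "nat \<Rightarrow> nat \<Rightarrow> (nat list list \<Rightarrow> bool) \<Rightarrow> bool" where
  "recog n B P \<longleftrightarrow>
     (\<exists>\<delta> q0 F. q0 < B \<and> (\<forall>q<B. \<forall>c. \<delta> q c < B) \<and>
        (\<forall>ws. length ws = n \<longrightarrow> (P ws \<longleftrightarrow> F (foldl \<delta> q0 (cols ws)))))"

text \<open>The constructions use structured states such as pairs and sets; a bijection with an
  initial segment of the numbers renames them.\<close>

lemma recogI:
  fixes \<delta> :: "'q \<Rightarrow> nat list \<Rightarrow> 'q"
  assumes Q: "finite Q" "card Q \<le> B" "q0 \<in> Q" "\<And>q c. q \<in> Q \<Longrightarrow> \<delta> q c \<in> Q"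
    and P: "\<And>ws. length ws = n \<Longrightarrow> P ws \<longleftrightarrow> F (foldl \<delta> q0 (cols ws))"
  shows "recog n B P"
proof -
  obtain b where b: "bij_betw b Q {0..<card Q}"
    using ex_bij_betw_finite_nat[OF Q(1)] by blast
  define g where "g = inv_into Q b"
  have g: "g (b q) = q" if "q \<in> Q" for q
    using b that unfolding g_def bij_betw_def by simp
  have gQ: "g k \<in> Q" if "k < card Q" for k
    using b that bij_betw_apply[OF bij_betw_inv_into[OF b]] unfolding g_def by simp
  have bB: "b q < B" if "q \<in> Q" for q
    using bij_betw_apply[OF b that] Q(2) by simp
  \<comment> \<open>Numbers from \<open>card Q\<close> up to \<open>B\<close> name no state; they
    are sent to the initial state to stay below \<open>B\<close>.\<close>
  define \<delta>' where "\<delta>' k c = (if k < card Q then b (\<delta> (g k) c) else b q0)" for k c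
  have step: "\<delta>' (b q) c = b (\<delta> q c)" if "q \<in> Q" for q c
    using bij_betw_apply[OF b that] g that unfolding \<delta>'_def by simp
  have fold: "foldl \<delta>' (b q) cs = b (foldl \<delta> q cs) \<and> foldl \<delta> q cs \<in> Q" if "q \<in> Q" for q cs
    using that by (induction cs arbitrary: q) (auto simp: step Q(4))
  show ?thesis
    unfolding recog_def
  proof (intro exI conjI allI impI)
    show "b q0 < B" using bB Q(3) .
    show "\<delta>' k c < B" for k c
      unfolding \<delta>'_def using bB Q(3,4) gQ by simp
    show "P ws \<longleftrightarrow> (\<lambda>k. F (g k)) (foldl \<delta>' (b q0) (cols ws))" if "length ws = n" for ws
      using P[OF that] fold[OF Q(3), of "cols ws"] g by simp
  qed
qed

section \<open>Boolean operations and atomic predicates\<close>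

lemma recog_not: "recog n B P \<Longrightarrow> recog n B (\<lambda>ws. \<not> P ws)"
proof -
  assume "recog n B P"
  then obtain \<delta> q0 F where *: "q0 < B" "\<forall>q<B. \<forall>c. \<delta> q c < B"
      "\<forall>ws. length ws = n \<longrightarrow> (P ws \<longleftrightarrow> F (foldl \<delta> q0 (cols ws)))"
    unfolding recog_def by blast
  show "recog n B (\<lambda>ws. \<not> P ws)"
    unfolding recog_def
    by (rule exI[of _ \<delta>], rule exI[of _ q0], rule exI[of _ "\<lambda>q. \<not> F q"]) (use * in auto)
qed

lemma recog_conj:
  assumes "recog n B P" "recog n B' P'"
  shows "recog n (B * B') (\<lambda>ws. P ws \<and> P' ws)"
proof -
  obtain \<delta> q0 F where *: "q0 < B" "\<forall>q<B. \<forall>c. \<delta> q c < B"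
      "\<forall>ws. length ws = n \<longrightarrow> (P ws \<longleftrightarrow> F (foldl \<delta> q0 (cols ws)))"
    using assms(1) unfolding recog_def by blast
  obtain \<delta>' q0' F' where **: "q0' < B'" "\<forall>q<B'. \<forall>c. \<delta>' q c < B'"
      "\<forall>ws. length ws = n \<longrightarrow> (P' ws \<longleftrightarrow> F' (foldl \<delta>' q0' (cols ws)))"
    using assms(2) unfolding recog_def by blast
  have fold: "foldl (\<lambda>p c. (\<delta> (fst p) c, \<delta>' (snd p) c)) p cs =
      (foldl \<delta> (fst p) cs, foldl \<delta>' (snd p) cs)" for p cs
    by (induction cs arbitrary: p) auto
  show ?thesis
    by (rule recogI[of "{..<B} \<times> {..<B'}" _ "(q0, q0')" "\<lambda>p c. (\<delta> (fst p) c, \<delta>' (snd p) c)"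
          _ _ "\<lambda>p. F (fst p) \<and> F' (snd p)"])
      (use * ** in \<open>auto simp: fold\<close>)
qed

text \<open>The two states record whether the two tracks have agreed so far.\<close>

lemma recog_eq:
  assumes "i < n" "j < n"
  shows "recog n 2 (\<lambda>ws. ws ! i = ws ! j)"
proof (rule recogI[of UNIV _ True "\<lambda>b c. b \<and> c ! i = c ! j" _ _ "\<lambda>b. b"])
  fix ws :: "nat list list" assume l: "length ws = n"
  have fold: "foldl (\<lambda>b c. b \<and> c ! i = c ! j) b cs \<longleftrightarrow> b \<and> (\<forall>c\<in>set cs. c ! i = c ! j)"
    for b and cs :: "nat list list"
    by (induction cs arbitrary: b) auto
  show "ws ! i = ws ! j \<longleftrightarrow> foldl (\<lambda>b c. b \<and> c ! i = c ! j) True (cols ws)"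
  proof
    assume "ws ! i = ws ! j"
    then show "foldl (\<lambda>b c. b \<and> c ! i = c ! j) True (cols ws)"
      unfolding fold using assms l by (auto simp: cols_def)
  next
    assume *: "foldl (\<lambda>b c. b \<and> c ! i = c ! j) True (cols ws)"
    show "ws ! i = ws ! j"
    proof (rule digit_inject)
      fix m assume "m < max (length (ws ! i)) (length (ws ! j))"
      then have "m < maxlen ws"
        using assms l nth_mem[of i ws] nth_mem[of j ws] less_maxlen by (metis less_max_iff_disj)
      then show "digit m (ws ! i) = digit m (ws ! j)"
        using * assms l unfolding fold by (auto simp: cols_def)
    qed
  qed
qed auto

text \<open>
  Past the end of the selected words the selected part of a column is blank; an automaton on all
  columns skips these columns.
\<close>

lemma cols_select:
  assumes "set vs \<subseteq> {..<length ws}"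
  shows "cols (map ((!) ws) vs) =
    filter (\<lambda>c. \<exists>x\<in>set c. x \<noteq> 0) (map (\<lambda>c. map ((!) c) vs) (cols ws))"
proof -
  let ?L = "maxlen ws" and ?us = "map ((!) ws) vs"
  let ?c = "\<lambda>j. map (digit j) ?us"
  have le: "maxlen ?us \<le> ?L"
  proof (rule ccontr)
    assume "\<not> maxlen ?us \<le> ?L"
    then obtain i where "i \<in> set vs" "?L < length (ws ! i)" using less_maxlen[of ?L ?us] by auto
    then show False using assms less_maxlen[of ?L ws] nth_mem[of i ws] by auto
  qed
  have "map (\<lambda>c. map ((!) c) vs) (cols ws) = map ?c [0..<?L]"
    using assms by (auto simp: cols_def)
  also have "[0..<?L] = [0..<maxlen ?us] @ [maxlen ?us..<?L]"
    using le by (metis le_add_diff_inverse upt_add_eq_append zero_le)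
  also have "filter (\<lambda>c. \<exists>x\<in>set c. x \<noteq> 0) (map ?c \<dots>) = map ?c [0..<maxlen ?us]"
  proof -
    have "filter (\<lambda>c. \<exists>x\<in>set c. x \<noteq> 0) (map ?c [0..<maxlen ?us]) = map ?c [0..<maxlen ?us]"
    proof (rule filter_True, rule ballI)
      fix c assume "c \<in> set (map ?c [0..<maxlen ?us])"
      then obtain j where j: "c = ?c j" "j \<in> set [0..<maxlen ?us]"
        unfolding set_map by blast
      then obtain u where u: "u \<in> set ?us" "j < length u" using less_maxlen[of j ?us] by auto
      have "digit j u \<in> digit j ` set ?us" using u(1) by (rule imageI)
      then have "digit j u \<in> set c" unfolding j(1) by (simp only: set_map)
      moreover have "digit j u \<noteq> 0" using u(2) by (simp add: digit_eq)
      ultimately show "\<exists>x\<in>set c. x \<noteq> 0" by blast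
    qed
    moreover have "filter (\<lambda>c. \<exists>x\<in>set c. x \<noteq> 0) (map ?c [maxlen ?us..<?L]) = []"
    proof (rule filter_False)
      show "\<forall>c\<in>set (map ?c [maxlen ?us..<?L]). \<not> (\<exists>x\<in>set c. x \<noteq> 0)"
        using less_maxlen[of _ ?us] by (fastforce simp: digit_eq)
    qed
    ultimately show ?thesis by simp
  qed
  finally show ?thesis by (simp add: cols_def)
qed

text \<open>A simulation started in the initial states only ever meets initial states and targets of
  steps. These are at most as many as the two lists have entries, so the subset construction has at
  most this power of 2 as its number of states, a bound that can be read off the code. Columns whose
  selected part is blank leave the state unchanged, in accordance with
  \<open>cols_select\<close>.\<close>

lemma recog_accepts:
  assumes vs: "set vs \<subseteq> {..<n}"
  shows "recog n (2 ^ (length (nst M) + length (nsteps M)))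
    (\<lambda>ws. accepts M (map h (cols (map ((!) ws) vs))))"
proof -
  define sstep where "sstep S x = {hd (tl (tl (list_decode s))) |s.
      s \<in> set (nsteps M) \<and> hd (list_decode s) \<in> S \<and> hd (tl (list_decode s)) = x}" for S x
  have fold: "set (foldl (nstep M) S w) = foldl sstep (set S) w" for S w
  proof (induction w arbitrary: S)
    case (Cons x w)
    have "set (nstep M S x) = sstep (set S) x"
      by (auto simp: nstep_def sstep_def)
    then show ?case by (simp add: Cons)
  qed simp
  define p where "p c = map ((!) c) vs" for c :: "nat list"
  define nz where "nz c \<longleftrightarrow> (\<exists>x\<in>set c. x \<noteq> 0)" for c :: "nat list"
  let ?d = "\<lambda>S c. if nz (p c) then sstep S (h (p c)) else S"
  have skip: "foldl ?d S cs = foldl sstep S (map h (filter nz (map p cs)))" for S cs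
    by (induction cs arbitrary: S) auto
  define U where "U = set (nst M) \<union> (\<lambda>s. hd (tl (tl (list_decode s)))) ` set (nsteps M)"
  have fin: "finite U" by (simp add: U_def)
  have "card U \<le> card (set (nst M)) + card ((\<lambda>s. hd (tl (tl (list_decode s)))) ` set (nsteps M))"
    unfolding U_def by (rule card_Un_le)
  also have "\<dots> \<le> length (nst M) + length (nsteps M)"
    by (intro add_mono card_length order_trans[OF card_image_le]) auto
  finally have "card (Pow U) \<le> 2 ^ (length (nst M) + length (nsteps M))"
    by (simp add: card_Pow fin power_increasing)
  moreover have "?d S c \<in> Pow U" if "S \<in> Pow U" for S c
    using that by (auto simp: sstep_def U_def)
  moreover have "accepts M (map h (cols (map ((!) ws) vs))) \<longleftrightarrow>
      (\<exists>q\<in>foldl ?d (set (nst M)) (cols ws). q \<in> set (nfin M))" if "length ws = n" for ws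
    unfolding accepts_def fold skip
    using cols_select[of vs ws] vs that by (simp only: p_def[abs_def] nz_def[abs_def])
  ultimately show ?thesis
    using fin by (intro recogI[of "Pow U" _ "set (nst M)" ?d _ _ "\<lambda>S. \<exists>q\<in>S. q \<in> set (nfin M)"])
      (auto simp: U_def)
qed

text \<open>Pumping: the prefixes of lengths 0 to \<open>B\<close> are one more than the states, so
  two of them reach the same state, and the letters between them can be cut out. Iterating leaves at
  most \<open>B\<close> letters, all from the same alphabet.\<close>

lemma shorten_word:
  fixes \<delta> :: "nat \<Rightarrow> 'l \<Rightarrow> nat"
  assumes \<delta>: "\<And>q x. q < B \<Longrightarrow> \<delta> q x < B" and "q < B"
  shows "v \<in> lists A \<Longrightarrow> \<exists>v'\<in>lists A. length v' \<le> B \<and> foldl \<delta> q v' = foldl \<delta> q v"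
proof (induction v rule: length_induct)
  case (1 v)
  show ?case
  proof (cases "length v \<le> B")
    case False
    let ?f = "\<lambda>i. foldl \<delta> q (take i v)"
    have lt: "foldl \<delta> q u < B" for u
      using \<open>q < B\<close> by (induction u rule: rev_induct) (auto intro: \<delta>)
    have "card (?f ` {..B}) \<le> card {..<B}"
      by (rule card_mono) (auto intro: lt)
    then have "\<not> inj_on ?f {..B}" by (intro pigeonhole) simp
    then obtain i j where ij: "i < j" "j \<le> B" "?f i = ?f j"
      unfolding inj_on_def by (metis atMost_iff linorder_neqE_nat)
    let ?v = "take i v @ drop j v"
    have "foldl \<delta> q ?v = foldl \<delta> q (take j v @ drop j v)"
      unfolding foldl_append ij(3) ..
    then have "foldl \<delta> q ?v = foldl \<delta> q v" by simp
    moreover have "length ?v < length v" using ij False by simp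
    moreover have "?v \<in> lists A"
      using 1(2) by (auto dest: in_set_takeD in_set_dropD)
    ultimately show ?thesis using 1(1) by metis
  qed (use 1 in blast)
qed

text \<open>
  The quantified word is guessed letter by letter by a subset construction whose states also record
  whether it has ended. A word that is longer than all others meets only blanks in its tail, so
  pumping bounds its length.
\<close>

lemma recog_ex:
  assumes "recog (Suc n) B P"
  shows "recog n (2 ^ (B + B)) (\<lambda>ws. \<exists>w\<in>lists {..<k}. P (w # ws))"
    and "length ws = n \<Longrightarrow> \<exists>w\<in>lists {..<k}. P (w # ws) \<Longrightarrow>
      \<exists>w\<in>lists {..<k}. length w \<le> maxlen ws + B \<and> P (w # ws)"
proof -
  obtain \<delta> q0 F where q0: "q0 < B" and \<delta>: "\<And>q c. q < B \<Longrightarrow> \<delta> q c < B" and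
      P: "\<And>ws. length ws = Suc n \<Longrightarrow> P ws \<longleftrightarrow> F (foldl \<delta> q0 (cols ws))"
    using assms unfolding recog_def by blast
  define col where "col ws j = map (digit j) ws" for ws j
  \<comment> \<open>The state after \<open>m\<close> columns. Beyond the end of \<open>w\<close> its
    digits are blank, so only the first \<open>m\<close> letters of \<open>w\<close> matter.\<close>
  define st where "st ws w m = foldl \<delta> q0 (map (\<lambda>j. digit j w # col ws j) [0..<m])" for ws w m
  \<comment> \<open>A column of the part of the quantified word that extends beyond all words of
    \<open>ws\<close>.\<close>
  define tail where "tail x = Suc x # replicate n 0" for x
  have st_less: "st ws w m < B" for ws w m
    unfolding st_def by (induction m) (auto simp: q0 \<delta>)
  have cols_Cons: "cols (w # ws) = map (\<lambda>j. digit j w # col ws j) [0..<max (length w) (maxlen ws)]"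
    for w ws by (simp add: cols_def col_def)
  have P_st: "P (w # ws) \<longleftrightarrow> F (st ws w (max (length w) (maxlen ws)))" if "length ws = n" for w ws
    using that by (simp add: P cols_Cons st_def)
  have st_cong: "st ws w m = st ws w' m" if "take m w = take m w'" for ws w w' m
  proof -
    have "digit j w = digit j w'" if "j < m" for j
      using \<open>take m w = take m w'\<close> that
      by (metis (no_types, lifting) digit_eq length_take min_less_iff_conj nth_take)
    then show ?thesis unfolding st_def by (intro arg_cong[where f = "foldl \<delta> q0"]) auto
  qed
  have col_blank: "col ws j = replicate n 0" if "length ws = n" "maxlen ws \<le> j" for ws j
  proof -
    have "digit j w = 0" if "w \<in> set ws" for w
      using less_maxlen[of j ws] \<open>maxlen ws \<le> j\<close> that by (auto simp: digit_eq)
    then have "map (digit j) ws = map (\<lambda>_. 0) ws" by simp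
    then show ?thesis using that(1) by (simp add: col_def map_replicate_const)
  qed
  have st_tail: "st ws (u @ v) (length u + length v) = foldl \<delta> (st ws u (length u)) (map tail v)"
    if "length ws = n" "length u = maxlen ws" for ws u v
  proof -
    have "map (\<lambda>j. digit j (u @ v) # col ws j) [length u..<length u + length v] = map tail v"
    proof (rule nth_equalityI)
      fix i assume "i < length (map (\<lambda>j. digit j (u @ v) # col ws j) [length u..<length u + length v])"
      then have i: "i < length v" by simp
      then have "digit (length u + i) (u @ v) = Suc (v ! i)" by (simp add: digit_eq)
      moreover have "col ws (length u + i) = replicate n 0"
        using col_blank[OF that(1), of "length u + i"] that(2) by simp
      ultimately show "map (\<lambda>j. digit j (u @ v) # col ws j) [length u..<length u + length v] ! i = map tail v ! i"
        using i by (simp add: tail_def)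
    qed simp
    moreover have "st ws (u @ v) (length u) = st ws u (length u)"
      by (rule st_cong) simp
    moreover have "[0..<length u + length v] = [0..<length u] @ [length u..<length u + length v]"
      by (rule upt_add_eq_append) simp
    ultimately show ?thesis unfolding st_def by simp
  qed
  have P_long: "P ((u @ v) # ws) \<longleftrightarrow> F (foldl \<delta> (st ws u (length u)) (map tail v))"
    if "length ws = n" "length u = maxlen ws" for ws u v
    using P_st[OF that(1), of "u @ v"] st_tail[OF that, of v] that by simp

  \<comment> \<open>What the guesses for the quantified word can lead to after \<open>m\<close>
    columns. The flag is set once a blank has been read; a word of length exactly \<open>m\<close>
    has not ended yet and may still be continued.\<close>
  define S where "S ws m = (\<lambda>w. (st ws w m, length w < m)) ` lists {..<k}" for ws m
  \<comment> \<open>The guessed digit \<open>x\<close> is 0 for the blank or the successor of a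
    letter below \<open>k\<close>, hence \<open>x \<le> k\<close>. After the end of the word only
    blanks may follow.\<close>
  define D where "D T c = {(\<delta> q (x # c), x = 0) |q e x. (q, e) \<in> T \<and> (e \<longrightarrow> x = 0) \<and> x \<le> k}"
    for T c
  have S_0: "S ws 0 = {(q0, False)}" for ws
    by (auto simp: S_def st_def)
  have S_Suc: "S ws (Suc m) = D (S ws m) (col ws m)" for ws m
  proof (intro set_eqI iffI)
    fix p assume "p \<in> S ws (Suc m)"
    then obtain w where w: "w \<in> lists {..<k}" "p = (st ws w (Suc m), length w < Suc m)"
      unfolding S_def by auto
    have "w ! m < k" if "m < length w" using w(1) that by (auto simp: in_lists_conv_set)
    then have "digit m w \<le> k" "length w < m \<longrightarrow> digit m w = 0" "(length w < Suc m) = (digit m w = 0)"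
      by (auto simp: digit_eq)
    moreover have "st ws w (Suc m) = \<delta> (st ws w m) (digit m w # col ws m)"
      by (simp add: st_def)
    moreover have "(st ws w m, length w < m) \<in> S ws m" using w(1) unfolding S_def by blast
    moreover have "p = (st ws w (Suc m), length w < Suc m)" by (rule w(2))
    ultimately have "p = (\<delta> (st ws w m) (digit m w # col ws m), digit m w = 0)" by simp
    then show "p \<in> D (S ws m) (col ws m)"
      unfolding D_def
      using \<open>digit m w \<le> k\<close> \<open>length w < m \<longrightarrow> digit m w = 0\<close>
        \<open>(st ws w m, length w < m) \<in> S ws m\<close> by blast
  next
    fix p assume "p \<in> D (S ws m) (col ws m)"
    then obtain w x where w: "w \<in> lists {..<k}" "length w < m \<longrightarrow> x = 0" "x \<le> k"
        "p = (\<delta> (st ws w m) (x # col ws m), x = 0)"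
      unfolding D_def S_def by auto
    \<comment> \<open>The guess may disagree with \<open>w\<close> at position \<open>m\<close>: a
      blank cuts the word there, and a letter replaces everything from there on.\<close>
    obtain w' where w': "w' \<in> lists {..<k}" "take m w' = take m w" "digit m w' = x"
        "length w' < Suc m \<longleftrightarrow> x = 0"
    proof (cases x)
      case 0
      have "take m w \<in> lists {..<k}" using w(1) by (auto dest: in_set_takeD)
      then show ?thesis using 0 that[of "take m w"] by (simp add: digit_eq)
    next
      case (Suc y)
      then have "length (take m w) = m" using w(2) by simp
      moreover have "take m w @ [y] \<in> lists {..<k}" using w(1,3) Suc by (auto dest: in_set_takeD)
      ultimately show ?thesis using Suc that[of "take m w @ [y]"] by (simp add: digit_eq nth_append)
    qed
    then have "p = (st ws w' (Suc m), length w' < Suc m)"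
      using w(4) st_cong[OF w'(2)] by (simp add: st_def)
    then show "p \<in> S ws (Suc m)" using w'(1) unfolding S_def by blast
  qed
  have S_fold: "foldl D {(q0, False)} (map (col ws) [0..<m]) = S ws m" for ws m
    by (induction m) (simp_all add: S_0 S_Suc)
  \<comment> \<open>The automaton reads only the columns of \<open>ws\<close>. The rest
    \<open>v\<close> of a longer guessed word is absorbed into the acceptance condition; it must be
    empty if the word has already ended.\<close>
  define acc where "acc T \<longleftrightarrow> (\<exists>(q, e)\<in>T. \<exists>v\<in>lists {..<k}. (e \<longrightarrow> v = []) \<and> F (foldl \<delta> q (map tail v)))"
    for T
  have acc: "(\<exists>w\<in>lists {..<k}. P (w # ws)) \<longleftrightarrow> acc (S ws (maxlen ws))" if l: "length ws = n" for ws
  proof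
    assume "\<exists>w\<in>lists {..<k}. P (w # ws)"
    then obtain w where w: "w \<in> lists {..<k}" "P (w # ws)" by blast
    have in_S: "(st ws w (maxlen ws), length w < maxlen ws) \<in> S ws (maxlen ws)"
      using w(1) unfolding S_def by blast
    show "acc (S ws (maxlen ws))"
    proof (cases "length w < maxlen ws")
      case True
      then have "F (foldl \<delta> (st ws w (maxlen ws)) (map tail []))"
        using w(2) P_st[OF l] by (simp add: max_def)
      then show ?thesis using in_S unfolding acc_def by blast
    next
      case False
      define u v where "u = take (maxlen ws) w" and "v = drop (maxlen ws) w"
      have uv: "w = u @ v" "length u = maxlen ws" using False by (auto simp: u_def v_def)
      have "st ws u (maxlen ws) = st ws w (maxlen ws)" by (rule st_cong) (simp add: u_def)
      then have "F (foldl \<delta> (st ws w (maxlen ws)) (map tail v))"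
        using P_long[OF l uv(2), of v] w(2) uv by simp
      moreover have "v \<in> lists {..<k}" using w(1) uv(1) by simp
      ultimately show ?thesis using in_S False unfolding acc_def by blast
    qed
  next
    assume "acc (S ws (maxlen ws))"
    then obtain w v where w: "w \<in> lists {..<k}" "v \<in> lists {..<k}" "length w < maxlen ws \<longrightarrow> v = []"
        "F (foldl \<delta> (st ws w (maxlen ws)) (map tail v))"
      unfolding acc_def S_def by auto
    show "\<exists>w\<in>lists {..<k}. P (w # ws)"
    proof (cases "length w < maxlen ws")
      case True
      then show ?thesis using w P_st[OF l, of w] by (auto simp: max_def)
    next
      case False
      define u where "u = take (maxlen ws) w"
      have u: "length u = maxlen ws" using False by (simp add: u_def)
      have "st ws u (maxlen ws) = st ws w (maxlen ws)" by (rule st_cong) (simp add: u_def)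
      then have "P ((u @ v) # ws)" using P_long[OF l u, of v] w(4) u by simp
      moreover have "u @ v \<in> lists {..<k}" using w(1,2) by (auto simp: u_def dest: in_set_takeD)
      ultimately show ?thesis by blast
    qed
  qed
  show "recog n (2 ^ (B + B)) (\<lambda>ws. \<exists>w\<in>lists {..<k}. P (w # ws))"
  proof (rule recogI[of "Pow ({..<B} \<times> UNIV)" _ "{(q0, False)}" D _ _ acc])
    show "(\<exists>w\<in>lists {..<k}. P (w # ws)) \<longleftrightarrow> acc (foldl D {(q0, False)} (cols ws))"
      if "length ws = n" for ws
    proof -
      have "cols ws = map (col ws) [0..<maxlen ws]" by (simp add: cols_def col_def)
      then show ?thesis using acc[OF that] S_fold by simp
    qed
    \<comment> \<open>\<open>B\<close> states with a flag make \<open>B + B\<close> pairs; the new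
      states are sets of them.\<close>
    show "card (Pow ({..<B} \<times> (UNIV :: bool set))) \<le> 2 ^ (B + B)"
      by (simp add: card_Pow card_cartesian_product mult_2_right)
    show "D T c \<in> Pow ({..<B} \<times> UNIV)" if "T \<in> Pow ({..<B} \<times> UNIV)" for T c
      using that \<delta> by (auto simp: D_def)
  qed (use q0 in auto)

  assume l: "length ws = n" and "\<exists>w\<in>lists {..<k}. P (w # ws)"
  then obtain w where w: "w \<in> lists {..<k}" "P (w # ws)" by blast
  show "\<exists>w\<in>lists {..<k}. length w \<le> maxlen ws + B \<and> P (w # ws)"
  proof (cases "length w \<le> maxlen ws")
    case False
    define u v where "u = take (maxlen ws) w" and "v = drop (maxlen ws) w"
    have uv: "w = u @ v" "length u = maxlen ws" using False by (auto simp: u_def v_def)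
    then have "u \<in> lists {..<k}" "v \<in> lists {..<k}" using w(1) by auto
    \<comment> \<open>Only the part beyond \<open>ws\<close> is pumped, since there the columns
      depend on the letters of \<open>v\<close> alone; \<open>u\<close> keeps the length
      \<open>maxlen ws\<close>.\<close>
    obtain v' where v': "v' \<in> lists {..<k}" "length v' \<le> B"
        "foldl (\<lambda>q x. \<delta> q (tail x)) (st ws u (length u)) v' = foldl (\<lambda>q x. \<delta> q (tail x)) (st ws u (length u)) v"
      using shorten_word[of B "\<lambda>q x. \<delta> q (tail x)", OF \<delta> st_less \<open>v \<in> lists {..<k}\<close>] by blast
    then have "P ((u @ v') # ws)"
      using P_long[OF l uv(2)] w(2) uv(1) by (simp add: foldl_map)
    moreover have "u @ v' \<in> lists {..<k}" using \<open>u \<in> lists {..<k}\<close> v'(1) by simp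
    ultimately show ?thesis using v'(2) uv(2) by (intro bexI[of _ "u @ v'"]) auto
  qed (use w in force)
qed

text \<open>The argument \<open>c\<close> stands for the code of a presentation, and both halves are
  uniform in it. The evaluator and the predicate may differ on lists of a wrong length: the
  evaluator reads entries with \<open>hd\<close> and \<open>drop\<close>, which is matched with
  \<open>!\<close> only inside the list. The two halves belong together because the evaluator of a
  quantified predicate searches up to a length given by the state bound of its body.\<close>

definition automatic :: "nat \<Rightarrow> (nat \<Rightarrow> nat list list \<Rightarrow> bool) \<Rightarrow> bool" where
  "automatic n P \<longleftrightarrow>
     (\<exists>P'. computable (\<lambda>p. P' (fst p) (snd p)) \<and> (\<forall>c ws. length ws = n \<longrightarrow> P' c ws = P c ws)) \<and>
     (\<exists>B. computable B \<and> (\<forall>c. recog n (B c) (P c)))"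

lemma automaticI:
  assumes "computable (\<lambda>p. P' (fst p) (snd p))" "\<And>c ws. length ws = n \<Longrightarrow> P' c ws = P c ws"
    and "computable B" "\<And>c. recog n (B c) (P c)"
  shows "automatic n P"
  unfolding automatic_def using assms by blast

lemma automaticE:
  assumes "automatic n P"
  obtains P' B where "computable (\<lambda>p. P' (fst p) (snd p))"
    "\<And>c ws. length ws = n \<Longrightarrow> P' c ws = P c ws"
    "computable B" "\<And>c. recog n (B c) (P c)"
  using assms unfolding automatic_def by blast

section \<open>Closure of the automatic predicates under the logical operations\<close>

lemma automatic_not:
  assumes "automatic n P"
  shows "automatic n (\<lambda>c ws. \<not> P c ws)"
proof -
  obtain P' B where P: "computable (\<lambda>p. P' (fst p) (snd p))"
    "\<And>c ws. length ws = n \<Longrightarrow> P' c ws = P c ws" "computable B" "\<And>c. recog n (B c) (P c)"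
    using assms by (rule automaticE) blast
  show ?thesis
    by (rule automaticI[of "\<lambda>c ws. \<not> P' c ws" _ _ B]) (simp_all add: P comp_not recog_not)
qed

lemma automatic_conj:
  assumes "automatic n P" "automatic n Q"
  shows "automatic n (\<lambda>c ws. P c ws \<and> Q c ws)"
proof -
  obtain P' B where P: "computable (\<lambda>p. P' (fst p) (snd p))"
    "\<And>c ws. length ws = n \<Longrightarrow> P' c ws = P c ws" "computable B" "\<And>c. recog n (B c) (P c)"
    using assms(1) by (rule automaticE) blast
  obtain Q' C where Q: "computable (\<lambda>p. Q' (fst p) (snd p))"
    "\<And>c ws. length ws = n \<Longrightarrow> Q' c ws = Q c ws" "computable C" "\<And>c. recog n (C c) (Q c)"
    using assms(2) by (rule automaticE) blast
  show ?thesis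
    by (rule automaticI[of "\<lambda>c ws. P' c ws \<and> Q' c ws" _ _ "\<lambda>c. B c * C c"])
      (simp_all add: P Q comp_conj comp_mult recog_conj)
qed

lemma automatic_eq:
  assumes "i < n" "j < n"
  shows "automatic n (\<lambda>c ws. ws ! i = ws ! j)"
proof (rule automaticI[of "\<lambda>c ws. hd (drop i ws) = hd (drop j ws)" _ _ "\<lambda>c. 2"])
  show "computable (\<lambda>p. hd (drop i (snd p)) = hd (drop j (snd (p :: nat \<times> nat list list))))"
    by (intro comp_intros comp_const comp_id)
qed (use assms in \<open>simp_all add: hd_drop_conv_nth comp_const recog_eq\<close>)

lemma automatic_accepts:
  assumes "set vs \<subseteq> {..<n}" "computable M" "computable h"
  shows "automatic n (\<lambda>c ws. accepts (M c) (map h (cols (map ((!) ws) vs))))"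
proof (rule automaticI[of "\<lambda>c ws. accepts (M c) (map h (cols (map (\<lambda>i. hd (drop i ws)) vs)))" _ _
      "\<lambda>c. 2 ^ (length (nst (M c)) + length (nsteps (M c)))"])
  show "computable (\<lambda>p. accepts (M (fst p))
      (map h (cols (map (\<lambda>i. hd (drop i (snd (p :: nat \<times> nat list list)))) vs))))"
    by (intro comp_intros comp_const comp_id comp_compose[OF assms(2)] comp_compose[OF assms(3)])
  show "computable (\<lambda>c. 2 ^ (length (nst (M c)) + length (nsteps (M c))) :: nat)"
    unfolding nst_def nsteps_def by (intro comp_intros comp_const comp_id assms)
  show "recog n (2 ^ (length (nst (M c)) + length (nsteps (M c))))
      (\<lambda>ws. accepts (M c) (map h (cols (map ((!) ws) vs))))" for c
    by (rule recog_accepts[OF assms(1)])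
  fix c and ws :: "nat list list" assume "length ws = n"
  then have "map (\<lambda>i. hd (drop i ws)) vs = map ((!) ws) vs"
    using assms(1) by (intro map_cong) (auto simp: hd_drop_conv_nth)
  then show "accepts (M c) (map h (cols (map (\<lambda>i. hd (drop i ws)) vs))) =
      accepts (M c) (map h (cols (map ((!) ws) vs)))" by (simp only:)
qed

lemma automatic_ex:
  assumes "automatic (Suc n) P" and K: "computable K"
  shows "automatic n (\<lambda>c ws. \<exists>w\<in>lists {..<K c}. P c (w # ws))"
proof -
  obtain P' B where P: "computable (\<lambda>p. P' (fst p) (snd p))"
    "\<And>c ws. length ws = Suc n \<Longrightarrow> P' c ws = P c ws" "computable B" "\<And>c. recog (Suc n) (B c) (P c)"
    using assms(1) by (rule automaticE) blast
  show ?thesis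
  proof (rule automaticI[of "\<lambda>c ws. \<exists>w\<in>set (words (K c) (maxlen ws + B c)). P' c (w # ws)" _ _
        "\<lambda>c. 2 ^ (B c + B c)"])
    show "computable (\<lambda>p. \<exists>w\<in>set (words (K (fst p)) (maxlen (snd p) + B (fst p))). P' (fst p) (w # snd p))"
      by (intro comp_intros comp_const comp_id comp_compose2[OF P(1)]
          comp_compose[OF P(3)] comp_compose[OF K])
    show "computable (\<lambda>c. 2 ^ (B c + B c) :: nat)" by (intro comp_intros P)
    show "recog n (2 ^ (B c + B c)) (\<lambda>ws. \<exists>w\<in>lists {..<K c}. P c (w # ws))" for c
      by (rule recog_ex(1)[OF P(4)])
    show "(\<exists>w\<in>set (words (K c) (maxlen ws + B c)). P' c (w # ws)) \<longleftrightarrow>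
        (\<exists>w\<in>lists {..<K c}. P c (w # ws))" if l: "length ws = n" for c ws
      using recog_ex(2)[OF P(4) l, of "K c" c] l by (auto simp: set_words P(2))
  qed
qed

section \<open>Model checking on regular presentations\<close>

definition field :: "nat \<Rightarrow> nat \<Rightarrow> nat" where
  "field i c = hd (drop i (list_decode c))"

lemma comp_field [comp_intros]: "computable f \<Longrightarrow> computable (\<lambda>e. field i (f e))"
  unfolding field_def by (intro comp_intros comp_const)

lemma field_code_presentation:
  "field 0 (code_presentation p) = alph p"
  "field (Suc 0) (code_presentation p) = code_nfa id (autS p)"
  "field 2 (code_presentation p) = code_nfa id (autP p)"
  "field 3 (code_presentation p) = code_nfa id (autA p)"
  "field 4 (code_presentation p) = code_nfa code_tuple (autDelta p)"
  "field 5 (code_presentation p) = code_nfa code_tuple (autPlus p)"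
  "field 6 (code_presentation p) = code_nfa code_tuple (autR p)"
  by (simp_all add: field_def code_presentation_def numeral_eq_Suc)

text \<open>The automata of the universes read plain letters, not columns. Subtracting 1 from the
  only entry of a column undoes the shift of \<open>digit\<close>.\<close>

definition in_univ :: "nat \<Rightarrow> nat \<Rightarrow> nat list \<Rightarrow> bool" where
  "in_univ i c w \<longleftrightarrow> accepts (field i c) (map (\<lambda>l. hd l - 1) (cols [w]))"

text \<open>\<open>list_encode\<close> of a column is \<open>code_tuple\<close> of the corresponding
  letter of the convolution.\<close>

definition in_rel :: "nat \<Rightarrow> nat \<Rightarrow> nat list list \<Rightarrow> bool" where
  "in_rel i c ws \<longleftrightarrow> accepts (field i c) (map list_encode (cols ws))"

lemma automatic_in_univ: "j < n \<Longrightarrow> automatic n (\<lambda>c ws. in_univ i c (ws ! j))"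
  using automatic_accepts[of "[j]" n "field i" "\<lambda>l. hd l - 1"]
  by (simp add: in_univ_def comp_intros comp_id comp_const)

lemma automatic_in_rel:
  assumes "set vs \<subseteq> {..<n}"
  shows "automatic n (\<lambda>c ws. in_rel i c (map ((!) ws) vs))"
proof -
  have "computable list_encode"
    using comp_enc[of "\<lambda>xs :: nat list. xs"] by (simp add: enc_nat_list comp_id)
  then show ?thesis
    unfolding in_rel_def by (intro automatic_accepts assms comp_intros comp_id)
qed

lemma in_univ_iff: "field i c = code_nfa id M \<Longrightarrow> in_univ i c w \<longleftrightarrow> w \<in> lang M"
proof -
  have "map (\<lambda>l. hd l - 1) (cols [w]) = w"
    by (rule nth_equalityI) (simp_all add: cols_def digit_eq)
  then show "field i c = code_nfa id M \<Longrightarrow> ?thesis"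
    using accepts_code_nfa[of id M w] by (simp add: in_univ_def)
qed

lemma in_rel_iff:
  assumes "field i c = code_nfa code_tuple M" "ws \<noteq> []"
  shows "in_rel i c ws \<longleftrightarrow> conv ws \<in> lang M"
proof -
  have "inj code_letter"
  proof
    show "code_letter x = code_letter y \<Longrightarrow> x = y" for x y by (cases x; cases y) auto
  qed
  then have "inj code_tuple"
    by (intro injI) (auto simp: code_tuple_def list_encode_eq inj_map_eq_map)
  moreover have "map list_encode (cols ws) = map code_tuple (conv ws)"
    using assms(2) by (simp add: cols_conv code_tuple_def)
  ultimately show ?thesis
    using accepts_code_nfa[of code_tuple M "conv ws"] assms(1) by (simp add: in_rel_def)
qed

lemma conv_inject:
  fixes us vs :: "nat list list"
  assumes "length us = length vs" "us \<noteq> []"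
  shows "conv us = conv vs \<longleftrightarrow> us = vs"
proof -
  have "vs \<noteq> []" using assms by auto
  then show ?thesis
    using cols_inject[OF assms(1)] cols_conv[of us] cols_conv[of vs] assms(2) by auto
qed

text \<open>An isomorphism from a structure of words onto the relational variant, with the graphs of
  weight function and addition already spelled out as equations.\<close>

locale presented =
  fixes p :: presentation and W :: "('s, 'a) wts" and R :: "('s \<times> 's) set"
    and T :: "(nat list, nat list, nat list) rel_struct"
    and f :: "nat list \<Rightarrow> 's" and g :: "nat list \<Rightarrow> nat" and h :: "nat list \<Rightarrow> 'a"
  assumes wts: "is_wts W"
    and recognises: "recognises p T"
    and bij_f: "bij_betw f (US T) (confs W)"
    and bij_g: "bij_betw g (UP T) (weights W)"
    and bij_h: "bij_betw h (UA T) (acts W)"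
    and Delta: "\<lbrakk>s \<in> US T; a \<in> UA T; t \<in> US T; x \<in> UP T\<rbrakk> \<Longrightarrow>
      (s, a, t, x) \<in> DeltaR T \<longleftrightarrow> g x = wt W (f s) (h a) (f t)"
    and Plus: "\<lbrakk>x \<in> UP T; y \<in> UP T; z \<in> UP T\<rbrakk> \<Longrightarrow> (x, y, z) \<in> PlusR T \<longleftrightarrow> g x + g y = g z"
    and Rel: "\<lbrakk>s \<in> US T; t \<in> US T\<rbrakk> \<Longrightarrow> (s, t) \<in> BinR T \<longleftrightarrow> (f s, f t) \<in> R"
begin

abbreviation "code \<equiv> code_presentation p"

lemma in_univ_US: "in_univ (Suc 0) code w \<longleftrightarrow> w \<in> US T"
  and in_univ_UP: "in_univ 2 code w \<longleftrightarrow> w \<in> UP T"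
  and in_univ_UA: "in_univ 3 code w \<longleftrightarrow> w \<in> UA T"
  using recognises by (simp_all add: in_univ_iff field_code_presentation recognises_def)

lemma univ_lists: "US T \<subseteq> lists {..<alph p}" "UP T \<subseteq> lists {..<alph p}" "UA T \<subseteq> lists {..<alph p}"
  using recognises by (simp_all add: recognises_def)

lemma in_rel_Delta:
  "\<lbrakk>s \<in> US T; a \<in> UA T; t \<in> US T; x \<in> UP T\<rbrakk> \<Longrightarrow>
    in_rel 4 code [s, a, t, x] \<longleftrightarrow> g x = wt W (f s) (h a) (f t)"
  using recognises
  by (auto simp: in_rel_iff field_code_presentation recognises_def conv_inject Delta[symmetric])

lemma in_rel_Plus:
  "\<lbrakk>x \<in> UP T; y \<in> UP T; z \<in> UP T\<rbrakk> \<Longrightarrow> in_rel 5 code [x, y, z] \<longleftrightarrow> g x + g y = g z"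
  using recognises
  by (auto simp: in_rel_iff field_code_presentation recognises_def conv_inject Plus[symmetric])

lemma in_rel_Rel:
  "\<lbrakk>s \<in> US T; t \<in> US T\<rbrakk> \<Longrightarrow> in_rel 6 code [s, t] \<longleftrightarrow> (f s, f t) \<in> R"
  using recognises
  by (auto simp: in_rel_iff field_code_presentation recognises_def conv_inject Rel[symmetric])

lemma f_eq_iff: "s \<in> US T \<Longrightarrow> t \<in> US T \<Longrightarrow> f s = f t \<longleftrightarrow> s = t"
  using bij_f by (auto simp: bij_betw_def inj_on_eq_iff)

lemma g_eq_iff: "x \<in> UP T \<Longrightarrow> y \<in> UP T \<Longrightarrow> g x = g y \<longleftrightarrow> x = y"
  using bij_g by (auto simp: bij_betw_def inj_on_eq_iff)

lemma h_eq_iff: "a \<in> UA T \<Longrightarrow> c \<in> UA T \<Longrightarrow> h a = h c \<longleftrightarrow> a = c"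
  using bij_h by (auto simp: bij_betw_def inj_on_eq_iff)

lemma bex_confs: "(\<exists>s\<in>confs W. Q s) \<longleftrightarrow> (\<exists>w\<in>US T. Q (f w))"
  unfolding bij_betw_imp_surj_on[OF bij_f, symmetric] by simp

lemma bex_weights: "(\<exists>x\<in>weights W. Q x) \<longleftrightarrow> (\<exists>w\<in>UP T. Q (g w))"
  unfolding bij_betw_imp_surj_on[OF bij_g, symmetric] by simp

lemma bex_acts: "(\<exists>a\<in>acts W. Q a) \<longleftrightarrow> (\<exists>w\<in>UA T. Q (h w))"
  unfolding bij_betw_imp_surj_on[OF bij_h, symmetric] by simp

text \<open>\<open>pos\<close> is the index in \<open>ws\<close> of the word that represents the value of a variable.\<close>

definition agree :: "(var \<Rightarrow> nat) \<Rightarrow> nat list list \<Rightarrow>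
    (nat \<Rightarrow> 's) \<Rightarrow> (nat \<Rightarrow> nat) \<Rightarrow> (nat \<Rightarrow> 'a) \<Rightarrow> var \<Rightarrow> bool" where
  "agree pos ws es ep ea v \<longleftrightarrow>
     (case v of
        SV x \<Rightarrow> ws ! pos v \<in> US T \<and> es x = f (ws ! pos v)
      | PV x \<Rightarrow> ws ! pos v \<in> UP T \<and> ep x = g (ws ! pos v)
      | AV x \<Rightarrow> ws ! pos v \<in> UA T \<and> ea x = h (ws ! pos v))"

text \<open>Since every intermediate value of a term lies in the universe of weights, it is
  represented by a word and can be quantified over when terms are flattened.\<close>

lemma wval_weights:
  "\<forall>v\<in>wvars u. agree pos ws es ep ea v \<Longrightarrow> wval W es ep ea u \<in> weights W"
proof (induction u)
  case (WVar x)
  then show ?case using bij_g by (auto simp: agree_def bij_betw_def)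
next
  case (Delta s a t)
  then have "es s \<in> confs W" "ea a \<in> acts W" "es t \<in> confs W"
    using bij_f bij_h by (auto simp: agree_def bij_betw_def)
  then show ?case using wts by (simp add: is_wts_def)
next
  case (Plus u v)
  then show ?case using wts by (simp add: is_wts_def)
qed

lemma wval_witness:
  assumes "\<forall>v\<in>wvars u. agree pos ws es ep ea v"
  obtains x where "x \<in> UP T" "g x = wval W es ep ea u"
  using wval_weights[OF assms] unfolding bij_betw_imp_surj_on[OF bij_g, symmetric] by force

end

text \<open>The predicates must not depend on the presentation, hence the statements outside the locale.\<close>

abbreviation bind_pos :: "(var \<Rightarrow> nat) \<Rightarrow> var \<Rightarrow> var \<Rightarrow> nat" where
  "bind_pos pos v \<equiv> (\<lambda>u. Suc (pos u))(v := 0)"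

text \<open>The graph of a term, with track \<open>r\<close> carrying the value. A sum is flattened:
  its operands get two new tracks, which are related to track \<open>r\<close> by the automaton for
  addition.\<close>

lemma automatic_wval:
  fixes u :: wterm
  assumes "r < n" "\<And>v. v \<in> wvars u \<Longrightarrow> pos v < n"
  shows "\<exists>P. automatic n P \<and>
    (\<forall>p (W :: ('s, 'a) wts) R T f g h ws es ep ea.
       presented p W R T f g h \<longrightarrow> length ws = n \<longrightarrow>
       (\<forall>v\<in>wvars u. presented.agree T f g h pos ws es ep ea v) \<longrightarrow> ws ! r \<in> UP T \<longrightarrow>
       (P (code_presentation p) ws \<longleftrightarrow> g (ws ! r) = wval W es ep ea u))"
  using assms
proof (induction u arbitrary: n pos r)
  case (WVar x)
  have aut: "automatic n (\<lambda>c ws. ws ! pos (PV x) = ws ! r)"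
    using WVar by (intro automatic_eq) auto
  show ?case
  proof (intro exI conjI allI impI, rule aut)
    fix p and W :: "('s, 'a) wts" and R T f g h and ws :: "nat list list" and es ep ea
    assume "presented p W R T f g h"
    then interpret presented p W R T f g h .
    assume "\<forall>v\<in>wvars (WVar x). agree pos ws es ep ea v" "ws ! r \<in> UP T"
    then show "ws ! pos (PV x) = ws ! r \<longleftrightarrow> g (ws ! r) = wval W es ep ea (WVar x)"
      by (auto simp: agree_def g_eq_iff)
  qed
next
  case (Delta s a t)
  have aut: "automatic n (\<lambda>c ws. in_rel 4 c (map ((!) ws) [pos (SV s), pos (AV a), pos (SV t), r]))"
    using Delta by (intro automatic_in_rel) auto
  show ?case
  proof (intro exI conjI allI impI, rule aut)
    fix p and W :: "('s, 'a) wts" and R T f g h and ws :: "nat list list" and es ep ea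
    assume "presented p W R T f g h"
    then interpret presented p W R T f g h .
    assume "\<forall>v\<in>wvars (Delta s a t). agree pos ws es ep ea v" "ws ! r \<in> UP T"
    then show "in_rel 4 code (map ((!) ws) [pos (SV s), pos (AV a), pos (SV t), r]) \<longleftrightarrow>
        g (ws ! r) = wval W es ep ea (Delta s a t)"
      by (auto simp: agree_def in_rel_Delta)
  qed
next
  case (Plus u u')
  let ?pos = "\<lambda>v. Suc (Suc (pos v))"
  obtain P where P: "automatic (Suc (Suc n)) P"
    "\<And>p (W :: ('s, 'a) wts) R T f g h ws es ep ea.
       \<lbrakk>presented p W R T f g h; length ws = Suc (Suc n);
        \<forall>v\<in>wvars u. presented.agree T f g h ?pos ws es ep ea v; ws ! 0 \<in> UP T\<rbrakk> \<Longrightarrow>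
       P (code_presentation p) ws \<longleftrightarrow> g (ws ! 0) = wval W es ep ea u"
    using Plus.IH(1)[of 0 "Suc (Suc n)" ?pos] Plus.prems by fastforce
  obtain P' where P': "automatic (Suc (Suc n)) P'"
    "\<And>p (W :: ('s, 'a) wts) R T f g h ws es ep ea.
       \<lbrakk>presented p W R T f g h; length ws = Suc (Suc n);
        \<forall>v\<in>wvars u'. presented.agree T f g h ?pos ws es ep ea v; ws ! 1 \<in> UP T\<rbrakk> \<Longrightarrow>
       P' (code_presentation p) ws \<longleftrightarrow> g (ws ! 1) = wval W es ep ea u'"
    using Plus.IH(2)[of 1 "Suc (Suc n)" ?pos] Plus.prems by fastforce
  \<comment> \<open>\<open>x\<close> and \<open>y\<close> will be prepended in this order, so they
    occupy tracks 0 and 1 and all other tracks move by two. The membership tests are essential, as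
    \<open>P\<close> and \<open>P'\<close> are specified only on words that represent
    weights.\<close>
  define Q where "Q c ws \<longleftrightarrow> ((in_univ 2 c (ws ! 0) \<and> in_univ 2 c (ws ! 1)) \<and> (P c ws \<and> P' c ws)) \<and>
    in_rel 5 c (map ((!) ws) [0, 1, Suc (Suc r)])" for c ws
  have "automatic (Suc (Suc n)) Q"
    unfolding Q_def using Plus.prems(1)
    by (intro automatic_conj P(1) P'(1) automatic_in_univ automatic_in_rel) auto
  then have "automatic (Suc n) (\<lambda>c ws. \<exists>x\<in>lists {..<field 0 c}. Q c (x # ws))"
    by (intro automatic_ex comp_intros comp_id)
  then have aut: "automatic n (\<lambda>c ws. \<exists>y\<in>lists {..<field 0 c}. \<exists>x\<in>lists {..<field 0 c}. Q c (x # y # ws))"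
    by (intro automatic_ex[where P = "\<lambda>c ws. \<exists>x\<in>lists {..<field 0 c}. Q c (x # ws)"] comp_intros comp_id)
  show ?case
  proof (intro exI conjI allI impI, rule aut)
    fix p and W :: "('s, 'a) wts" and R T f g h and ws :: "nat list list" and es ep ea
    assume pres: "presented p W R T f g h"
    then interpret presented p W R T f g h .
    assume l: "length ws = n" and ag: "\<forall>v\<in>wvars (Plus u u'). agree pos ws es ep ea v"
      and r: "ws ! r \<in> UP T"
    have ag2: "\<forall>v\<in>wvars u. agree ?pos (x # y # ws) es ep ea v"
      "\<forall>v\<in>wvars u'. agree ?pos (x # y # ws) es ep ea v" for x y
      using ag by (auto simp: agree_def split: var.splits)
    have Q: "Q code (x # y # ws) \<longleftrightarrow> x \<in> UP T \<and> y \<in> UP T \<and>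
        g x = wval W es ep ea u \<and> g y = wval W es ep ea u' \<and> g x + g y = g (ws ! r)" for x y
    proof (cases "x \<in> UP T \<and> y \<in> UP T")
      case True
      then show ?thesis
        using P(2)[OF pres _ ag2(1)[of x y]] P'(2)[OF pres _ ag2(2)[of x y]] l r
        by (simp add: Q_def in_univ_UP in_rel_Plus)
    qed (auto simp: Q_def in_univ_UP)
    obtain x0 where x0: "x0 \<in> UP T" "g x0 = wval W es ep ea u"
      using wval_witness[of u pos ws es ep ea] ag by auto
    obtain y0 where y0: "y0 \<in> UP T" "g y0 = wval W es ep ea u'"
      using wval_witness[of u' pos ws es ep ea] ag by auto
    show "(\<exists>y\<in>lists {..<field 0 code}. \<exists>x\<in>lists {..<field 0 code}. Q code (x # y # ws)) \<longleftrightarrow>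
        g (ws ! r) = wval W es ep ea (Plus u u')"
    proof
      assume "g (ws ! r) = wval W es ep ea (Plus u u')"
      then have "Q code (x0 # y0 # ws)" using x0 y0 unfolding Q by simp
      moreover have "x0 \<in> lists {..<field 0 code}" "y0 \<in> lists {..<field 0 code}"
        using x0 y0 univ_lists by (auto simp: field_code_presentation)
      ultimately show "\<exists>y\<in>lists {..<field 0 code}. \<exists>x\<in>lists {..<field 0 code}. Q code (x # y # ws)"
        by blast
    qed (auto simp: Q)
  qed
qed

text \<open>A quantifier prepends the word of its variable: \<open>bind_pos\<close> puts that
  variable on track 0 and shifts the others, which also handles rebinding. An equation between terms
  says that some weight is the value of both.\<close>

lemma automatic_sat:
  fixes \<phi> :: fm
  assumes "\<And>v. v \<in> fv \<phi> \<Longrightarrow> pos v < n"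
  shows "\<exists>P. automatic n P \<and>
    (\<forall>p (W :: ('s, 'a) wts) R T f g h ws es ep ea.
       presented p W R T f g h \<longrightarrow> length ws = n \<longrightarrow>
       (\<forall>v\<in>fv \<phi>. presented.agree T f g h pos ws es ep ea v) \<longrightarrow>
       (P (code_presentation p) ws \<longleftrightarrow> sat W R es ep ea \<phi>))"
  using assms
proof (induction \<phi> arbitrary: n pos)
  case (EqS s t)
  have aut: "automatic n (\<lambda>c ws. ws ! pos (SV s) = ws ! pos (SV t))"
    using EqS by (intro automatic_eq) auto
  show ?case
  proof (intro exI conjI allI impI, rule aut)
    fix p and W :: "('s, 'a) wts" and R T f g h and ws :: "nat list list" and es ep ea
    assume "presented p W R T f g h"
    then interpret presented p W R T f g h .
    assume "\<forall>v\<in>fv (EqS s t). agree pos ws es ep ea v"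
    then show "ws ! pos (SV s) = ws ! pos (SV t) \<longleftrightarrow> sat W R es ep ea (EqS s t)"
      by (auto simp: agree_def f_eq_iff)
  qed
next
  case (EqA a c)
  have aut: "automatic n (\<lambda>_ ws. ws ! pos (AV a) = ws ! pos (AV c))"
    using EqA by (intro automatic_eq) auto
  show ?case
  proof (intro exI conjI allI impI, rule aut)
    fix p and W :: "('s, 'a) wts" and R T f g h and ws :: "nat list list" and es ep ea
    assume "presented p W R T f g h"
    then interpret presented p W R T f g h .
    assume "\<forall>v\<in>fv (EqA a c). agree pos ws es ep ea v"
    then show "ws ! pos (AV a) = ws ! pos (AV c) \<longleftrightarrow> sat W R es ep ea (EqA a c)"
      by (auto simp: agree_def h_eq_iff)
  qed
next
  case (EqP u u')
  let ?pos = "\<lambda>v. Suc (pos v)"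
  obtain P where P: "automatic (Suc n) P"
    "\<And>p (W :: ('s, 'a) wts) R T f g h ws es ep ea.
       \<lbrakk>presented p W R T f g h; length ws = Suc n;
        \<forall>v\<in>wvars u. presented.agree T f g h ?pos ws es ep ea v; ws ! 0 \<in> UP T\<rbrakk> \<Longrightarrow>
       P (code_presentation p) ws \<longleftrightarrow> g (ws ! 0) = wval W es ep ea u"
    using automatic_wval[of 0 "Suc n" u ?pos] EqP by fastforce
  obtain P' where P': "automatic (Suc n) P'"
    "\<And>p (W :: ('s, 'a) wts) R T f g h ws es ep ea.
       \<lbrakk>presented p W R T f g h; length ws = Suc n;
        \<forall>v\<in>wvars u'. presented.agree T f g h ?pos ws es ep ea v; ws ! 0 \<in> UP T\<rbrakk> \<Longrightarrow>
       P' (code_presentation p) ws \<longleftrightarrow> g (ws ! 0) = wval W es ep ea u'"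
    using automatic_wval[of 0 "Suc n" u' ?pos] EqP by fastforce
  have "automatic (Suc n) (\<lambda>c ws. in_univ 2 c (ws ! 0) \<and> P c ws \<and> P' c ws)"
    by (intro automatic_conj automatic_in_univ P P') simp
  from automatic_ex[OF this, of "field 0"]
  have aut: "automatic n (\<lambda>c ws. \<exists>x\<in>lists {..<field 0 c}. in_univ 2 c x \<and> P c (x # ws) \<and> P' c (x # ws))"
    by (simp add: comp_field comp_id)
  show ?case
  proof (intro exI conjI allI impI, rule aut)
    fix p and W :: "('s, 'a) wts" and R T f g h and ws :: "nat list list" and es ep ea
    assume pres: "presented p W R T f g h"
    then interpret presented p W R T f g h .
    assume l: "length ws = n" and ag: "\<forall>v\<in>fv (EqP u u'). agree pos ws es ep ea v"
    have ag2: "\<forall>v\<in>wvars u. agree ?pos (x # ws) es ep ea v"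
      "\<forall>v\<in>wvars u'. agree ?pos (x # ws) es ep ea v" for x
      using ag by (auto simp: agree_def split: var.splits)
    have Q: "in_univ 2 code x \<and> P code (x # ws) \<and> P' code (x # ws) \<longleftrightarrow>
        x \<in> UP T \<and> g x = wval W es ep ea u \<and> g x = wval W es ep ea u'" for x
    proof (cases "x \<in> UP T")
      case True
      then show ?thesis
        using P(2)[OF pres _ ag2(1)[of x]] P'(2)[OF pres _ ag2(2)[of x]] l
        by (simp add: in_univ_UP)
    qed (auto simp: in_univ_UP)
    obtain x0 where x0: "x0 \<in> UP T" "g x0 = wval W es ep ea u"
      using wval_witness[of u pos ws es ep ea] ag by auto
    have "x0 \<in> lists {..<field 0 code}"
      using x0 univ_lists by (auto simp: field_code_presentation)
    then show "(\<exists>x\<in>lists {..<field 0 code}. in_univ 2 code x \<and> P code (x # ws) \<and> P' code (x # ws)) \<longleftrightarrow>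
        sat W R es ep ea (EqP u u')"
      unfolding Q using x0 by (auto intro!: bexI[of _ x0])
  qed
next
  case (Rel s t)
  have aut: "automatic n (\<lambda>c ws. in_rel 6 c (map ((!) ws) [pos (SV s), pos (SV t)]))"
    using Rel by (intro automatic_in_rel) auto
  show ?case
  proof (intro exI conjI allI impI, rule aut)
    fix p and W :: "('s, 'a) wts" and R T f g h and ws :: "nat list list" and es ep ea
    assume "presented p W R T f g h"
    then interpret presented p W R T f g h .
    assume "\<forall>v\<in>fv (Rel s t). agree pos ws es ep ea v"
    then show "in_rel 6 code (map ((!) ws) [pos (SV s), pos (SV t)]) \<longleftrightarrow> sat W R es ep ea (Rel s t)"
      by (auto simp: agree_def in_rel_Rel)
  qed
next
  case (Neg \<phi>)
  obtain P where P: "automatic n P"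
    "\<And>p (W :: ('s, 'a) wts) R T f g h ws es ep ea.
       \<lbrakk>presented p W R T f g h; length ws = n;
        \<forall>v\<in>fv \<phi>. presented.agree T f g h pos ws es ep ea v\<rbrakk> \<Longrightarrow>
       P (code_presentation p) ws \<longleftrightarrow> sat W R es ep ea \<phi>"
    using Neg.IH[of pos n] Neg.prems by fastforce
  show ?case
    by (intro exI conjI, rule automatic_not[OF P(1)]) (auto simp: P(2))
next
  case (Conj \<phi> \<psi>)
  obtain P where P: "automatic n P"
    "\<And>p (W :: ('s, 'a) wts) R T f g h ws es ep ea.
       \<lbrakk>presented p W R T f g h; length ws = n;
        \<forall>v\<in>fv \<phi>. presented.agree T f g h pos ws es ep ea v\<rbrakk> \<Longrightarrow>
       P (code_presentation p) ws \<longleftrightarrow> sat W R es ep ea \<phi>"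
    using Conj.IH(1)[of pos n] Conj.prems by fastforce
  obtain P' where P': "automatic n P'"
    "\<And>p (W :: ('s, 'a) wts) R T f g h ws es ep ea.
       \<lbrakk>presented p W R T f g h; length ws = n;
        \<forall>v\<in>fv \<psi>. presented.agree T f g h pos ws es ep ea v\<rbrakk> \<Longrightarrow>
       P' (code_presentation p) ws \<longleftrightarrow> sat W R es ep ea \<psi>"
    using Conj.IH(2)[of pos n] Conj.prems by fastforce
  show ?case
  proof (intro exI conjI allI impI, rule automatic_conj[OF P(1) P'(1)])
    fix p and W :: "('s, 'a) wts" and R T f g h and ws :: "nat list list" and es ep ea
    assume pres: "presented p W R T f g h" "length ws = n"
      and ag: "\<forall>v\<in>fv (Conj \<phi> \<psi>). presented.agree T f g h pos ws es ep ea v"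
    then have "\<forall>v\<in>fv \<phi>. presented.agree T f g h pos ws es ep ea v"
      "\<forall>v\<in>fv \<psi>. presented.agree T f g h pos ws es ep ea v" by auto
    then show "P (code_presentation p) ws \<and> P' (code_presentation p) ws \<longleftrightarrow>
        sat W R es ep ea (Conj \<phi> \<psi>)"
      using P(2)[OF pres] P'(2)[OF pres] by simp
  qed
next
  case (ExS x \<phi>)
  let ?pos = "bind_pos pos (SV x)"
  have pos: "?pos v < Suc n" if "v \<in> fv \<phi>" for v
    using ExS.prems[of v] that by auto
  obtain P where P: "automatic (Suc n) P"
    "\<And>p (W :: ('s, 'a) wts) R T f g h ws es ep ea.
       \<lbrakk>presented p W R T f g h; length ws = Suc n;
        \<forall>v\<in>fv \<phi>. presented.agree T f g h ?pos ws es ep ea v\<rbrakk> \<Longrightarrow>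
       P (code_presentation p) ws \<longleftrightarrow> sat W R es ep ea \<phi>"
    using ExS.IH[of ?pos "Suc n", OF pos] by fastforce
  have "automatic (Suc n) (\<lambda>c ws. in_univ (Suc 0) c (ws ! 0) \<and> P c ws)"
    by (intro automatic_conj automatic_in_univ P) simp
  from automatic_ex[OF this, of "field 0"]
  have aut: "automatic n (\<lambda>c ws. \<exists>w\<in>lists {..<field 0 c}. in_univ (Suc 0) c w \<and> P c (w # ws))"
    by (simp add: comp_field comp_id)
  show ?case
  proof (intro exI conjI allI impI, rule aut)
    fix p and W :: "('s, 'a) wts" and R T f g h and ws :: "nat list list" and es ep ea
    assume pres: "presented p W R T f g h"
    then interpret presented p W R T f g h .
    assume l: "length ws = n" and ag: "\<forall>v\<in>fv (ExS x \<phi>). agree pos ws es ep ea v"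
    have "P code (w # ws) \<longleftrightarrow> sat W R (es(x := f w)) ep ea \<phi>" if "w \<in> US T" for w
    proof (rule P(2)[OF pres])
      show "\<forall>v\<in>fv \<phi>. agree ?pos (w # ws) (es(x := f w)) ep ea v"
        using ag that by (auto simp: agree_def split: var.splits)
    qed (simp add: l)
    then show "(\<exists>w\<in>lists {..<field 0 code}. in_univ (Suc 0) code w \<and> P code (w # ws)) \<longleftrightarrow>
        sat W R es ep ea (ExS x \<phi>)"
      using univ_lists(1) by (simp add: bex_confs in_univ_US field_code_presentation) blast
  qed
next
  case (ExP x \<phi>)
  let ?pos = "bind_pos pos (PV x)"
  have pos: "?pos v < Suc n" if "v \<in> fv \<phi>" for v
    using ExP.prems[of v] that by auto
  obtain P where P: "automatic (Suc n) P"
    "\<And>p (W :: ('s, 'a) wts) R T f g h ws es ep ea.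
       \<lbrakk>presented p W R T f g h; length ws = Suc n;
        \<forall>v\<in>fv \<phi>. presented.agree T f g h ?pos ws es ep ea v\<rbrakk> \<Longrightarrow>
       P (code_presentation p) ws \<longleftrightarrow> sat W R es ep ea \<phi>"
    using ExP.IH[of ?pos "Suc n", OF pos] by fastforce
  have "automatic (Suc n) (\<lambda>c ws. in_univ 2 c (ws ! 0) \<and> P c ws)"
    by (intro automatic_conj automatic_in_univ P) simp
  from automatic_ex[OF this, of "field 0"]
  have aut: "automatic n (\<lambda>c ws. \<exists>w\<in>lists {..<field 0 c}. in_univ 2 c w \<and> P c (w # ws))"
    by (simp add: comp_field comp_id)
  show ?case
  proof (intro exI conjI allI impI, rule aut)
    fix p and W :: "('s, 'a) wts" and R T f g h and ws :: "nat list list" and es ep ea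
    assume pres: "presented p W R T f g h"
    then interpret presented p W R T f g h .
    assume l: "length ws = n" and ag: "\<forall>v\<in>fv (ExP x \<phi>). agree pos ws es ep ea v"
    have "P code (w # ws) \<longleftrightarrow> sat W R es (ep(x := g w)) ea \<phi>" if "w \<in> UP T" for w
    proof (rule P(2)[OF pres])
      show "\<forall>v\<in>fv \<phi>. agree ?pos (w # ws) es (ep(x := g w)) ea v"
        using ag that by (auto simp: agree_def split: var.splits)
    qed (simp add: l)
    then show "(\<exists>w\<in>lists {..<field 0 code}. in_univ 2 code w \<and> P code (w # ws)) \<longleftrightarrow>
        sat W R es ep ea (ExP x \<phi>)"
      using univ_lists(2) by (simp add: bex_weights in_univ_UP field_code_presentation) blast
  qed
next
  case (ExA x \<phi>)
  let ?pos = "bind_pos pos (AV x)"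
  have pos: "?pos v < Suc n" if "v \<in> fv \<phi>" for v
    using ExA.prems[of v] that by auto
  obtain P where P: "automatic (Suc n) P"
    "\<And>p (W :: ('s, 'a) wts) R T f g h ws es ep ea.
       \<lbrakk>presented p W R T f g h; length ws = Suc n;
        \<forall>v\<in>fv \<phi>. presented.agree T f g h ?pos ws es ep ea v\<rbrakk> \<Longrightarrow>
       P (code_presentation p) ws \<longleftrightarrow> sat W R es ep ea \<phi>"
    using ExA.IH[of ?pos "Suc n", OF pos] by fastforce
  have "automatic (Suc n) (\<lambda>c ws. in_univ 3 c (ws ! 0) \<and> P c ws)"
    by (intro automatic_conj automatic_in_univ P) simp
  from automatic_ex[OF this, of "field 0"]
  have aut: "automatic n (\<lambda>c ws. \<exists>w\<in>lists {..<field 0 c}. in_univ 3 c w \<and> P c (w # ws))"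
    by (simp add: comp_field comp_id)
  show ?case
  proof (intro exI conjI allI impI, rule aut)
    fix p and W :: "('s, 'a) wts" and R T f g h and ws :: "nat list list" and es ep ea
    assume pres: "presented p W R T f g h"
    then interpret presented p W R T f g h .
    assume l: "length ws = n" and ag: "\<forall>v\<in>fv (ExA x \<phi>). agree pos ws es ep ea v"
    have "P code (w # ws) \<longleftrightarrow> sat W R es ep (ea(x := h w)) \<phi>" if "w \<in> UA T" for w
    proof (rule P(2)[OF pres])
      show "\<forall>v\<in>fv \<phi>. agree ?pos (w # ws) es ep (ea(x := h w)) v"
        using ag that by (auto simp: agree_def split: var.splits)
    qed (simp add: l)
    then show "(\<exists>w\<in>lists {..<field 0 code}. in_univ 3 code w \<and> P code (w # ws)) \<longleftrightarrow>
        sat W R es ep ea (ExA x \<phi>)"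
      using univ_lists(3) by (simp add: bex_acts in_univ_UA field_code_presentation) blast
  qed
qed

lemma regular_presentation_presented:
  assumes "is_wts W" "regular_presentation p (relational_variant W R)"
  shows "\<exists>T f g h. presented p W R T f g h"
proof -
  obtain T f g h where T: "recognises p T"
    and bij: "bij_betw f (US T) (confs W)" "bij_betw g (UP T) (weights W)" "bij_betw h (UA T) (acts W)"
    and iso: "\<forall>s\<in>US T. \<forall>a\<in>UA T. \<forall>t\<in>US T. \<forall>x\<in>UP T.
        (s, a, t, x) \<in> DeltaR T \<longleftrightarrow> (f s, h a, f t, g x) \<in> DeltaR (relational_variant W R)"
      "\<forall>x\<in>UP T. \<forall>y\<in>UP T. \<forall>z\<in>UP T.
        (x, y, z) \<in> PlusR T \<longleftrightarrow> (g x, g y, g z) \<in> PlusR (relational_variant W R)"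
      "\<forall>s\<in>US T. \<forall>t\<in>US T. (s, t) \<in> BinR T \<longleftrightarrow> (f s, f t) \<in> BinR (relational_variant W R)"
    using assms(2) unfolding regular_presentation_def isomorphic_def
    by (auto simp: relational_variant_def)
  have "presented p W R T f g h"
  proof
    show "(s, a, t, x) \<in> DeltaR T \<longleftrightarrow> g x = wt W (f s) (h a) (f t)"
      if "s \<in> US T" "a \<in> UA T" "t \<in> US T" "x \<in> UP T" for s a t x
      using iso(1) that bij by (auto simp: relational_variant_def bij_betw_def)
    show "(x, y, z) \<in> PlusR T \<longleftrightarrow> g x + g y = g z" if "x \<in> UP T" "y \<in> UP T" "z \<in> UP T" for x y z
      using iso(2) that bij by (auto simp: relational_variant_def bij_betw_def)
    show "(s, t) \<in> BinR T \<longleftrightarrow> (f s, f t) \<in> R" if "s \<in> US T" "t \<in> US T" for s t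
      using iso(3) that by (auto simp: relational_variant_def)
  qed (use assms T bij in auto)
  then show ?thesis by blast
qed

text \<open>A sentence has no free variables to represent, so it yields a predicate of arity 0, and
  the decision procedure is its evaluator applied to the empty list.\<close>

lemma models_decidable:
  assumes "sentence \<Phi>"
  shows "\<exists>d. recursive 1 d \<and>
    (\<forall>p (W :: ('s, 'a) wts) R. is_wts W \<and> regular_presentation p (relational_variant W R) \<longrightarrow>
       d [code_presentation p] = (if models W R \<Phi> then 1 else 0))"
proof -
  obtain P where P: "automatic 0 P"
    "\<And>p (W :: ('s, 'a) wts) R T f g h ws es ep ea.
       \<lbrakk>presented p W R T f g h; length ws = 0;
        \<forall>v\<in>fv \<Phi>. presented.agree T f g h (\<lambda>_. 0) ws es ep ea v\<rbrakk> \<Longrightarrow>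
       P (code_presentation p) ws \<longleftrightarrow> sat W R es ep ea \<Phi>"
    using automatic_sat[of \<Phi> "\<lambda>_. 0" 0] assms unfolding sentence_def by fastforce
  obtain P' where P': "computable (\<lambda>p. P' (fst p) (snd p))"
    "\<And>c ws. length ws = 0 \<Longrightarrow> P' c ws = P c ws"
    using P(1) unfolding automatic_def by blast
  have "computable (\<lambda>c. P' c [])"
    by (intro comp_compose2[OF P'(1)] comp_id comp_const)
  then obtain g where g: "rf 1 (\<lambda>xs. g (xs ! 0))" "\<And>c. g c = of_bool (P' c [])"
    unfolding computable_def by auto
  obtain d where d: "recursive 1 d" "\<And>xs. length xs = 1 \<Longrightarrow> d xs = g (xs ! 0)"
    using g(1) unfolding rf_def by blast
  have "d [code_presentation p] = (if models W R \<Phi> then 1 else 0)"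
    if "is_wts W" "regular_presentation p (relational_variant W R)"
    for p and W :: "('s, 'a) wts" and R
  proof -
    obtain T f g h where "presented p W R T f g h"
      using regular_presentation_presented[OF \<open>is_wts W\<close> \<open>regular_presentation p _\<close>] by blast
    \<comment> \<open>The left-hand side does not mention the assignment, so all assignments give
      the value that \<open>models\<close> asks for.\<close>
    then have "P (code_presentation p) [] \<longleftrightarrow> sat W R es ep ea \<Phi>" for es ep ea
      using P(2)[of p W R T f g h "[]"] assms unfolding sentence_def by simp
    then show ?thesis by (auto simp: d(2) g(2) P'(2) models_def)
  qed
  then show ?thesis using d(1) by blast
qed

section \<open>The sentence expressing bisimilarity\<close>

definition AllS :: "nat \<Rightarrow> fm \<Rightarrow> fm" where
  "AllS x \<phi> = Neg (ExS x (Neg \<phi>))"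

definition AllA :: "nat \<Rightarrow> fm \<Rightarrow> fm" where
  "AllA x \<phi> = Neg (ExA x (Neg \<phi>))"

definition Imp :: "fm \<Rightarrow> fm \<Rightarrow> fm" where
  "Imp \<phi> \<psi> = Neg (Conj \<phi> (Neg \<psi>))"

text \<open>\<open>AllS 0 (EqS 0 0)\<close> serves as a closed formula for truth; it holds even if
  there are no configurations.\<close>

definition conjs :: "fm list \<Rightarrow> fm" where
  "conjs \<phi>s = foldr Conj \<phi>s (AllS 0 (EqS 0 0))"

definition disjs :: "fm list \<Rightarrow> fm" where
  "disjs \<phi>s = Neg (conjs (map Neg \<phi>s))"

definition exs :: "nat list \<Rightarrow> fm \<Rightarrow> fm" where
  "exs xs \<phi> = foldr ExS xs \<phi>"

lemma sat_AllS [simp]: "sat W R es ep ea (AllS x \<phi>) \<longleftrightarrow> (\<forall>s\<in>confs W. sat W R (es(x := s)) ep ea \<phi>)"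
  by (simp add: AllS_def)

lemma sat_AllA [simp]: "sat W R es ep ea (AllA x \<phi>) \<longleftrightarrow> (\<forall>a\<in>acts W. sat W R es ep (ea(x := a)) \<phi>)"
  by (simp add: AllA_def)

lemma sat_Imp [simp]: "sat W R es ep ea (Imp \<phi> \<psi>) \<longleftrightarrow> (sat W R es ep ea \<phi> \<longrightarrow> sat W R es ep ea \<psi>)"
  by (simp add: Imp_def)

lemma sat_conjs [simp]: "sat W R es ep ea (conjs \<phi>s) \<longleftrightarrow> (\<forall>\<phi>\<in>set \<phi>s. sat W R es ep ea \<phi>)"
  unfolding conjs_def by (induction \<phi>s) auto

lemma sat_disjs [simp]: "sat W R es ep ea (disjs \<phi>s) \<longleftrightarrow> (\<exists>\<phi>\<in>set \<phi>s. sat W R es ep ea \<phi>)"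
  unfolding disjs_def by simp

lemma fv_AllS [simp]: "fv (AllS x \<phi>) = fv \<phi> - {SV x}"
  by (simp add: AllS_def)

lemma fv_AllA [simp]: "fv (AllA x \<phi>) = fv \<phi> - {AV x}"
  by (simp add: AllA_def)

lemma fv_Imp [simp]: "fv (Imp \<phi> \<psi>) = fv \<phi> \<union> fv \<psi>"
  by (simp add: Imp_def)

lemma fv_conjs [simp]: "fv (conjs \<phi>s) = (\<Union>\<phi>\<in>set \<phi>s. fv \<phi>)"
  unfolding conjs_def by (induction \<phi>s) auto

lemma fv_disjs [simp]: "fv (disjs \<phi>s) = (\<Union>\<phi>\<in>set \<phi>s. fv \<phi>)"
  unfolding disjs_def by simp

lemma fv_exs [simp]: "fv (exs xs \<phi>) = fv \<phi> - SV ` set xs"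
  unfolding exs_def by (induction xs) auto

definition upd :: "(nat \<Rightarrow> 's) \<Rightarrow> nat \<Rightarrow> 's list \<Rightarrow> nat \<Rightarrow> 's" where
  "upd es j ts i = (if j \<le> i \<and> i < j + length ts then ts ! (i - j) else es i)"

lemma sat_exs:
  "sat W R es ep ea (exs [j..<j + k] \<phi>) \<longleftrightarrow>
    (\<exists>ts. length ts = k \<and> set ts \<subseteq> confs W \<and> sat W R (upd es j ts) ep ea \<phi>)"
proof (induction k arbitrary: j es)
  case 0
  have "upd es j [] = es" by (auto simp add: upd_def fun_eq_iff)
  then show ?case by (simp add: exs_def)
next
  case (Suc k)
  have upd: "upd (es(j := t)) (Suc j) ts = upd es j (t # ts)" for t ts
    by (auto simp: upd_def fun_eq_iff nth_Cons')
  have "sat W R es ep ea (exs [j..<j + Suc k] \<phi>) \<longleftrightarrow>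
      (\<exists>t\<in>confs W. sat W R (es(j := t)) ep ea (exs [Suc j..<Suc j + k] \<phi>))"
  proof -
    have "[j..<j + Suc k] = j # [Suc j..<Suc j + k]" by (simp add: upt_conv_Cons del: upt_Suc)
    then show ?thesis unfolding exs_def by (simp del: upt_Suc)
  qed
  also have "\<dots> \<longleftrightarrow> (\<exists>t ts. length ts = k \<and> set (t # ts) \<subseteq> confs W \<and> sat W R (upd es j (t # ts)) ep ea \<phi>)"
    unfolding Suc upd by auto
  also have "\<dots> \<longleftrightarrow> (\<exists>ts. length ts = Suc k \<and> set ts \<subseteq> confs W \<and> sat W R (upd es j ts) ep ea \<phi>)"
    by (metis length_Suc_conv)
  finally show ?case .
qed

text \<open>The weights need not contain 0, so a zero weight is characterised by idempotence.\<close>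

definition is_zero :: "nat \<Rightarrow> nat \<Rightarrow> nat \<Rightarrow> fm" where
  "is_zero s a t = EqP (Plus (Delta s a t) (Delta s a t)) (Delta s a t)"

lemma sat_is_zero [simp]: "sat W R es ep ea (is_zero s a t) \<longleftrightarrow> wt W (es s) (ea a) (es t) = 0"
  by (simp add: is_zero_def)

lemma fv_is_zero [simp]: "fv (is_zero s a t) = {SV s, AV a, SV t}"
  by (auto simp: is_zero_def)

text \<open>
  Configuration variables 0, 1 and 2 stand for the two related configurations and for a
  representative of the class, 3 is auxiliary, and those from 4 on range over the class. The summand
  \<open>Delta 0 0 2\<close>, common to both sums, makes up for the missing constant 0 when there is no other.
\<close>

definition weight_sum :: "nat \<Rightarrow> nat \<Rightarrow> wterm" where
  "weight_sum k s = foldr (\<lambda>i. Plus (Delta s 0 (4 + i))) [0..<k] (Delta 0 0 2)"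

definition same_sum :: "nat \<Rightarrow> fm" where
  "same_sum k = exs [4..<4 + k] (conjs
     [conjs (map (\<lambda>i. Rel 2 (4 + i)) [0..<k]),
      conjs (map (\<lambda>(i, j). Neg (EqS (4 + i) (4 + j)))
        (filter (\<lambda>(i, j). i \<noteq> j) (List.product [0..<k] [0..<k]))),
      AllS 3 (Imp (Conj (Rel 2 3) (Neg (Conj (is_zero 0 0 3) (is_zero 1 0 3))))
        (disjs (map (\<lambda>i. EqS 3 (4 + i)) [0..<k]))),
      EqP (weight_sum k 0) (weight_sum k 1)])"

text \<open>Classes are not elements of the structure, so each is named by a representative,
  variable 2. \<open>Suc\<close> makes the list of admissible lengths include
  \<open>2 * b\<close>.\<close>

definition bisim_sentence :: "nat \<Rightarrow> fm" where
  "bisim_sentence b = conjs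
     [AllS 0 (Rel 0 0),
      AllS 0 (AllS 1 (Imp (Rel 0 1) (Rel 1 0))),
      AllS 0 (AllS 1 (AllS 2 (Imp (Conj (Rel 0 1) (Rel 1 2)) (Rel 0 2)))),
      AllS 0 (AllS 1 (AllS 2 (AllA 0 (Imp (Rel 0 1) (disjs (map same_sum [0..<Suc (2 * b)]))))))]"

lemma wvars_weight_sum: "wvars (weight_sum k s) \<subseteq> {SV 0, SV s, SV 2, AV 0} \<union> SV ` {4..<4 + k}"
proof -
  have "wvars (foldr (\<lambda>i. Plus (Delta s 0 (4 + i))) xs (Delta 0 0 2)) \<subseteq>
      {SV 0, SV s, SV 2, AV 0} \<union> (\<lambda>i. SV (4 + i)) ` set xs" for xs
    by (induction xs) auto
  from this[of "[0..<k]"] show ?thesis unfolding weight_sum_def by force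
qed

lemma fv_same_sum: "fv (same_sum k) \<subseteq> {SV 0, SV 1, SV 2, AV 0}"
proof -
  let ?V = "{SV 0, SV 1, SV 2, AV 0} \<union> SV ` {4..<4 + k}"
  have V: "SV (4 + i) \<in> ?V" if "i < k" for i using that by simp
  have "fv (EqP (weight_sum k 0) (weight_sum k 1)) \<subseteq> ?V"
    using wvars_weight_sum[of k 0] wvars_weight_sum[of k 1] by auto
  moreover have "fv (conjs (map (\<lambda>i. Rel 2 (4 + i)) [0..<k])) \<subseteq> ?V"
    using V by auto
  moreover have "fv (conjs (map (\<lambda>(i, j). Neg (EqS (4 + i) (4 + j)))
      (filter (\<lambda>(i, j). i \<noteq> j) (List.product [0..<k] [0..<k])))) \<subseteq> ?V"
    using V by auto
  moreover have "fv (AllS 3 (Imp (Conj (Rel 2 3) (Neg (Conj (is_zero 0 0 3) (is_zero 1 0 3))))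
      (disjs (map (\<lambda>i. EqS 3 (4 + i)) [0..<k])))) \<subseteq> ?V"
    using V by auto
  ultimately show ?thesis unfolding same_sum_def fv_exs fv_conjs by auto
qed

lemma sentence_bisim_sentence: "sentence (bisim_sentence b)"
  unfolding sentence_def bisim_sentence_def using fv_same_sum by (fastforce simp: numeral_2_eq_2)

section \<open>Meaning of the sentence\<close>

lemma wval_weight_sum:
  "wval W es ep ea (weight_sum k s) =
    (\<Sum>i\<leftarrow>[0..<k]. wt W (es s) (ea 0) (es (4 + i))) + wt W (es 0) (ea 0) (es 2)"
proof -
  have "wval W es ep ea (foldr (\<lambda>i. Plus (Delta s 0 (4 + i))) xs (Delta 0 0 2)) =
      (\<Sum>i\<leftarrow>xs. wt W (es s) (ea 0) (es (4 + i))) + wt W (es 0) (ea 0) (es 2)" for xs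
    by (induction xs) auto
  then show ?thesis unfolding weight_sum_def .
qed

lemma sat_same_sum:
  "sat W R es ep ea (same_sum k) \<longleftrightarrow>
    (\<exists>ts. length ts = k \<and> set ts \<subseteq> confs W \<and> (\<forall>t\<in>set ts. (es 2, t) \<in> R) \<and> distinct ts \<and>
      (\<forall>x\<in>confs W. (es 2, x) \<in> R \<longrightarrow>
        wt W (es 0) (ea 0) x \<noteq> 0 \<or> wt W (es 1) (ea 0) x \<noteq> 0 \<longrightarrow> x \<in> set ts) \<and>
      (\<Sum>t\<leftarrow>ts. wt W (es 0) (ea 0) t) = (\<Sum>t\<leftarrow>ts. wt W (es 1) (ea 0) t))"
proof -
  have upd: "upd es 4 ts 0 = es 0" "upd es 4 ts (Suc 0) = es (Suc 0)" "upd es 4 ts 2 = es 2"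
    "\<And>i. i < length ts \<Longrightarrow> upd es 4 ts (4 + i) = ts ! i" for ts
    by (simp_all add: upd_def)
  have sum: "(\<Sum>i\<leftarrow>[0..<length ts]. F (upd es 4 ts (4 + i))) = (\<Sum>t\<leftarrow>ts. F t)" for F and ts
  proof -
    have "map (\<lambda>i. F (upd es 4 ts (4 + i))) [0..<length ts] = map F ts"
      by (rule nth_equalityI) (simp_all add: upd)
    then show ?thesis by (simp only:)
  qed
  have body: "sat W R (upd es 4 ts) ep ea (conjs
     [conjs (map (\<lambda>i. Rel 2 (4 + i)) [0..<k]),
      conjs (map (\<lambda>(i, j). Neg (EqS (4 + i) (4 + j)))
        (filter (\<lambda>(i, j). i \<noteq> j) (List.product [0..<k] [0..<k]))),
      AllS 3 (Imp (Conj (Rel 2 3) (Neg (Conj (is_zero 0 0 3) (is_zero 1 0 3))))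
        (disjs (map (\<lambda>i. EqS 3 (4 + i)) [0..<k]))),
      EqP (weight_sum k 0) (weight_sum k 1)]) \<longleftrightarrow>
    (\<forall>t\<in>set ts. (es 2, t) \<in> R) \<and> distinct ts \<and>
      (\<forall>x\<in>confs W. (es 2, x) \<in> R \<longrightarrow>
        wt W (es 0) (ea 0) x \<noteq> 0 \<or> wt W (es 1) (ea 0) x \<noteq> 0 \<longrightarrow> x \<in> set ts) \<and>
      (\<Sum>t\<leftarrow>ts. wt W (es 0) (ea 0) t) = (\<Sum>t\<leftarrow>ts. wt W (es 1) (ea 0) t)"
    (is "sat _ _ _ _ _ (conjs [?A, ?B, ?C, ?D]) \<longleftrightarrow> _") if l: "length ts = k" for ts
  proof -
    have "sat W R (upd es 4 ts) ep ea ?A \<longleftrightarrow> (\<forall>t\<in>set ts. (es 2, t) \<in> R)"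
      using l by (auto simp: upd all_set_conv_all_nth)
    moreover have "sat W R (upd es 4 ts) ep ea ?B \<longleftrightarrow> distinct ts"
      using l by (auto simp: upd distinct_conv_nth)
    moreover have "sat W R (upd es 4 ts) ep ea ?C \<longleftrightarrow> (\<forall>x\<in>confs W. (es 2, x) \<in> R \<longrightarrow>
        wt W (es 0) (ea 0) x \<noteq> 0 \<or> wt W (es 1) (ea 0) x \<noteq> 0 \<longrightarrow> x \<in> set ts)"
    proof -
      have "(\<exists>i\<in>{0..<k}. x = upd es 4 ts (4 + i)) \<longleftrightarrow> x \<in> set ts" for x
        using l by (auto simp: upd in_set_conv_nth)
      then show ?thesis by (simp add: upd) blast
    qed
    \<comment> \<open>Both sides contain the same extra summand, the weight from \<open>es 0\<close>
      to \<open>es 2\<close>, which cancels.\<close>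
    moreover have "sat W R (upd es 4 ts) ep ea ?D \<longleftrightarrow>
        (\<Sum>t\<leftarrow>ts. wt W (es 0) (ea 0) t) = (\<Sum>t\<leftarrow>ts. wt W (es 1) (ea 0) t)"
      using sum[of "wt W (es 0) (ea 0)" ts] sum[of "wt W (es 1) (ea 0)" ts] l
      by (simp add: wval_weight_sum upd)
    moreover have "sat W R (upd es 4 ts) ep ea (conjs [?A, ?B, ?C, ?D]) \<longleftrightarrow>
        sat W R (upd es 4 ts) ep ea ?A \<and> sat W R (upd es 4 ts) ep ea ?B \<and>
        sat W R (upd es 4 ts) ep ea ?C \<and> sat W R (upd es 4 ts) ep ea ?D"
      by (simp only: sat_conjs list.set ball_simps simp_thms)
    ultimately show ?thesis by (simp only:)
  qed
  show ?thesis
    unfolding same_sum_def sat_exs by (intro ex_cong1 conj_cong refl) (rule body)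
qed

text \<open>All summands outside \<open>ts\<close> vanish, so the infinite sum is a finite one, and
  distinctness makes the list count each summand once.\<close>

lemma infsum_class:
  fixes F :: "'s \<Rightarrow> nat"
  assumes "distinct ts" "set ts \<subseteq> E" "\<And>x. x \<in> E \<Longrightarrow> F x \<noteq> 0 \<Longrightarrow> x \<in> set ts"
  shows "(\<Sum>\<^sub>\<infinity>t\<in>E. F t) = (\<Sum>t\<leftarrow>ts. F t)"
proof -
  have "(\<Sum>\<^sub>\<infinity>t\<in>E. F t) = (\<Sum>\<^sub>\<infinity>t\<in>set ts. F t)"
    using assms by (intro infsum_cong_neutral) auto
  then show ?thesis using assms(1) by (simp add: sum_list_distinct_conv_sum_set)
qed

lemma sat_disjs_same_sum:
  assumes R: "R \<subseteq> confs W \<times> confs W" and b: "bounded_branching b W"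
    and es: "es 0 \<in> confs W" "es 1 \<in> confs W" "ea 0 \<in> acts W"
  shows "sat W R es ep ea (disjs (map same_sum [0..<Suc (2 * b)])) \<longleftrightarrow>
    (\<Sum>\<^sub>\<infinity>t\<in>R `` {es 2}. wt W (es 0) (ea 0) t) = (\<Sum>\<^sub>\<infinity>t\<in>R `` {es 2}. wt W (es 1) (ea 0) t)"
    (is "?L \<longleftrightarrow> _")
proof
  let ?S = "\<lambda>i. \<Sum>\<^sub>\<infinity>t\<in>R `` {es 2}. wt W (es i) (ea 0) t"
  assume ?L
  then obtain ts where ts: "\<forall>t\<in>set ts. (es 2, t) \<in> R" "distinct ts"
      "\<forall>x\<in>confs W. (es 2, x) \<in> R \<longrightarrow>
        wt W (es 0) (ea 0) x \<noteq> 0 \<or> wt W (es 1) (ea 0) x \<noteq> 0 \<longrightarrow> x \<in> set ts"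
      "(\<Sum>t\<leftarrow>ts. wt W (es 0) (ea 0) t) = (\<Sum>t\<leftarrow>ts. wt W (es 1) (ea 0) t)"
    by (auto simp: sat_same_sum)
  \<comment> \<open>The sentence quantifies over configurations only; since \<open>R\<close> relates
    only configurations, this covers the whole class.\<close>
  have "x \<in> set ts" if "x \<in> R `` {es 2}" "wt W (es 0) (ea 0) x \<noteq> 0 \<or> wt W (es 1) (ea 0) x \<noteq> 0" for x
    using ts(3) that R by auto
  then have "?S 0 = (\<Sum>t\<leftarrow>ts. wt W (es 0) (ea 0) t)" "?S 1 = (\<Sum>t\<leftarrow>ts. wt W (es 1) (ea 0) t)"
    using ts(1) by (intro infsum_class ts(2); blast)+
  then show "?S 0 = ?S 1" using ts(4) by simp
next
  let ?S = "\<lambda>i. \<Sum>\<^sub>\<infinity>t\<in>R `` {es 2}. wt W (es i) (ea 0) t"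
  assume eq: "?S 0 = ?S 1"
  define N where "N i = {t \<in> confs W. wt W (es i) (ea 0) t \<noteq> 0}" for i
  \<comment> \<open>The members of the class with nonzero weight from either configuration. They lie
    in the union of two supports of at most \<open>b\<close> elements each, which is where
    \<open>2 * b\<close> comes from.\<close>
  define F where "F = R `` {es 2} \<inter> (N 0 \<union> N 1)"
  have N: "finite (N 0)" "card (N 0) \<le> b" "finite (N 1)" "card (N 1) \<le> b"
    using b es unfolding bounded_branching_def N_def by auto
  have "card F \<le> card (N 0 \<union> N 1)"
    unfolding F_def by (rule card_mono) (use N in auto)
  also have "\<dots> \<le> card (N 0) + card (N 1)" by (rule card_Un_le)
  also have "\<dots> \<le> 2 * b" using N by simp
  finally have "card F \<le> 2 * b" .
  have "finite F" unfolding F_def using N by auto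
  then obtain ts where ts: "set ts = F" "distinct ts" using finite_distinct_list by blast
  have in_ts: "x \<in> set ts \<longleftrightarrow> x \<in> confs W \<and> (es 2, x) \<in> R \<and>
      (wt W (es 0) (ea 0) x \<noteq> 0 \<or> wt W (es 1) (ea 0) x \<noteq> 0)" for x
    unfolding ts(1) F_def N_def by auto
  have "?S 0 = (\<Sum>t\<leftarrow>ts. wt W (es 0) (ea 0) t)" "?S 1 = (\<Sum>t\<leftarrow>ts. wt W (es 1) (ea 0) t)"
    using R in_ts by (intro infsum_class ts(2); blast)+
  then have "(\<Sum>t\<leftarrow>ts. wt W (es 0) (ea 0) t) = (\<Sum>t\<leftarrow>ts. wt W (es 1) (ea 0) t)"
    using eq by simp
  then have "sat W R es ep ea (same_sum (card F))"
    unfolding sat_same_sum ts(1)[symmetric] distinct_card[OF ts(2)]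
    using ts(2) in_ts by (intro exI[of _ ts]) blast
  moreover have "card F \<in> set [0..<Suc (2 * b)]" using \<open>card F \<le> 2 * b\<close> by auto
  ultimately show ?L unfolding sat_disjs set_map by blast
qed

lemma sat_bisim_sentence:
  assumes R: "R \<subseteq> confs W \<times> confs W" and b: "bounded_branching b W"
  shows "sat W R es ep ea (bisim_sentence b) \<longleftrightarrow> bisimulation W R"
proof -
  define D where "D = disjs (map same_sum [0..<Suc (2 * b)])"
  define Q where "Q s s' a E \<longleftrightarrow> (\<Sum>\<^sub>\<infinity>t\<in>E. wt W s a t) = (\<Sum>\<^sub>\<infinity>t\<in>E. wt W s' a t)" for s s' a E
  have "sat W R (es(0 := s, 1 := s', 2 := u)) ep (ea(0 := a)) D \<longleftrightarrow> Q s s' a (R `` {u})"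
    if "s \<in> confs W" "s' \<in> confs W" "a \<in> acts W" for s s' u a
    using sat_disjs_same_sum[OF R b, of "es(0 := s, 1 := s', 2 := u)" "ea(0 := a)" ep] that
    unfolding D_def[symmetric] Q_def by simp
  then have "sat W R es ep ea (bisim_sentence b) \<longleftrightarrow>
      ((\<forall>x\<in>confs W. (x, x) \<in> R) \<and>
       (\<forall>x\<in>confs W. \<forall>y\<in>confs W. (x, y) \<in> R \<longrightarrow> (y, x) \<in> R) \<and>
       (\<forall>x\<in>confs W. \<forall>y\<in>confs W. \<forall>z\<in>confs W. (x, y) \<in> R \<and> (y, z) \<in> R \<longrightarrow> (x, z) \<in> R)) \<and>
      (\<forall>s\<in>confs W. \<forall>s'\<in>confs W. \<forall>u\<in>confs W. \<forall>a\<in>acts W. (s, s') \<in> R \<longrightarrow> Q s s' a (R `` {u}))"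
    (is "_ \<longleftrightarrow> ?E \<and> ?S")
    unfolding bisim_sentence_def D_def[symmetric] by simp
  moreover have "equiv (confs W) R \<longleftrightarrow> ?E"
  proof
    assume "equiv (confs W) R"
    then show ?E by (elim equivE) (auto simp: refl_on_def dest: symD transD)
  next
    assume E: ?E
    show "equiv (confs W) R"
    proof (rule equivI[OF R])
      show "refl_on (confs W) R" using E by (simp add: refl_on_def)
      show "sym R" using E R by (intro symI) auto
      show "trans R"
      proof (rule transI)
        fix x y z assume xyz: "(x, y) \<in> R" "(y, z) \<in> R"
        then have "x \<in> confs W" "y \<in> confs W" "z \<in> confs W" using R by auto
        with E xyz show "(x, z) \<in> R" by blast
      qed
    qed
  qed
  \<comment> \<open>The classes in the quotient are exactly the images of single configurations
    under \<open>R\<close>, so quantifying over representatives reaches all of them.\<close>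
  moreover have "?S \<longleftrightarrow> (\<forall>(s, s')\<in>R. \<forall>a\<in>acts W. \<forall>E\<in>confs W // R. Q s s' a E)"
    using R by (fastforce simp: quotient_def)
  ultimately show ?thesis unfolding bisimulation_def Q_def by simp
qed

theorem theorem4:
  fixes b :: nat
  shows "\<exists>\<Phi>. sentence \<Phi> \<and>
    (\<forall>(W :: ('s, 'a) wts) R.
       is_wts W \<and> bounded_branching b W \<and> R \<subseteq> confs W \<times> confs W \<longrightarrow>
       (bisimulation W R \<longleftrightarrow> models W R \<Phi>)) \<and>
    (\<exists>d. recursive 1 d \<and>
       (\<forall>p (W :: ('s, 'a) wts) R.
          is_wts W \<and> bounded_branching b W \<and> R \<subseteq> confs W \<times> confs W \<and>
          regular_presentation p (relational_variant W R) \<longrightarrow>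
          d [code_presentation p] = (if models W R \<Phi> then 1 else 0)))"
proof -
  have "bisimulation W R \<longleftrightarrow> models W R (bisim_sentence b)"
    if "bounded_branching b W" "R \<subseteq> confs W \<times> confs W" for W :: "('s, 'a) wts" and R
    using sat_bisim_sentence[OF that(2,1)] unfolding models_def by simp
  moreover obtain d where "recursive 1 d"
    "\<forall>p (W :: ('s, 'a) wts) R. is_wts W \<and> regular_presentation p (relational_variant W R) \<longrightarrow>
       d [code_presentation p] = (if models W R (bisim_sentence b) then 1 else 0)"
    using models_decidable[OF sentence_bisim_sentence[of b]] by (elim exE conjE)
  ultimately show ?thesis
    by (intro exI[of _ "bisim_sentence b"] exI[of _ d] conjI allI impI sentence_bisim_sentence)
      (simp_all only:)
qed

end
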